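(* Let $B:\mathbb{R}\to\mathbb{R}$ be an admissible function (as defined in the context) which is also convex. Let $u:\mathbb{R}\to\mathbb{R}$ be smooth with $u''(x)\ge\lambda$ for all $x\in\mathbb{R}$, for some constant $\lambda>0$. Then there exists a constant $\theta>0$, independent of $h$, such that for every step size $h>0$, every $f^h\in\ell^\infty$ and every $t\geq 0$, $$\left\langle \left(P_t f^h-\langle P_t f^h,\pi^h\rangle\right)^2+\Gamma^h(P_t f^h,P_t f^h),\pi^h\right\rangle\le e^{-\theta t}\left\langle\left(f^h-\langle f^h,\pi^h\rangle\right)^2+\Gamma^h(f^h,f^h),\pi^h\right\rangle .$$
   Context: A function $B:\mathbb{R}\to\mathbb{R}$ is called admissible if $B\in C^1(\mathbb{R})$, $B$ is Lipschitz continuous, $B(0)=1$, $B(s)>0$ for all $s$, $\ln B(-s)-\ln B(s)=s$ for all $s$, and $B$ is monotonically decreasing. Given a potential $u$ and a step size $h>0$, set $x_i=ih$, $u_i=u(x_i)$ for $i\in\mathbb{Z}$, and $$\alpha_i=\frac{1}{h^2}B(u_{i+1}-u_i),\qquad \beta_i=\frac1{h^2}B(u_{i-1}-u_i),\qquad \pi_i=\frac{e^{-u_i}}{\sum_{j\in\mathbb{Z}}e^{-u_j}},\qquad \pi^h=\{\pi_i\}_{i\in\mathbb{Z}}.$$ For sequences $f^h=\{f_i\}_{i\in\mathbb{Z}}$, $g^h=\{g_i\}_{i\in\mathbb{Z}}$ of real numbers: $\langle f^h,g^h\rangle=\sum_{i\in\mathbb{Z}}f_ig_i$; products and squares are componentwise,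 and a constant is identified with the constant sequence; $\Delta^+f_i=f_{i+1}-f_i$, $\Delta^-f_i=f_i-f_{i-1}$; $$\left(\Gamma^h(f^h,g^h)\right)_i=\tfrac12\alpha_i\Delta^+f_i\Delta^+g_i+\tfrac12\beta_i\Delta^-f_i\Delta^-g_i.$$ $\ell^\infty$ is the space of bounded real sequences indexed by $\mathbb{Z}$. $P_t:\ell^\infty\to\ell^\infty$ is the semigroup generated by $\mathcal{L}_hf_i=\alpha_i(f_{i+1}-f_i)-\beta_i(f_i-f_{i-1})$, i.e. $(P_tf^h)_i=\mathbb{E}[f_{Z_t}\mid Z_0=i]=\sum_{j}f_j\,p_t(i,j)$, where $Z_t$ is the continuous-time Markov chain on $\mathbb{Z}$ jumping from $i$ to $i+1$ at rate $\alpha_i$ and from $i$ to $i-1$ at rate $\beta_i$, with transition probabilities $p_t(i,j)=\mathbb{P}(Z_t=j\mid Z_0=i)$ (the minimal nonnegative solution of the associated Kolmogorov backward equation with $p_0(i,j)=\delta_{ij}$). *)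

theory Defs
  imports "HOL-Analysis.Analysis"
begin

definition admissible :: "(real \<Rightarrow> real) \<Rightarrow> bool" where
  "admissible B \<longleftrightarrow>
     B C1_differentiable_on UNIV \<and>
     (\<exists>L. lipschitz_on L UNIV B) \<and>
     B 0 = 1 \<and>
     (\<forall>s. 0 < B s) \<and>
     (\<forall>s. ln (B (- s)) - ln (B s) = s) \<and>
     antimono B"

definition smooth_fun :: "(real \<Rightarrow> real) \<Rightarrow> bool" where
  "smooth_fun u \<longleftrightarrow> (\<forall>n x. (deriv ^^ n) u differentiable (at x))"

definition grid :: "(real \<Rightarrow> real) \<Rightarrow> real \<Rightarrow> int \<Rightarrow> real" where
  "grid u h i = u (of_int i * h)"

definition up_rate :: "(real \<Rightarrow> real) \<Rightarrow> (real \<Rightarrow> real) \<Rightarrow> real \<Rightarrow> int \<Rightarrow> real" where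
  "up_rate B u h i = 1 / h\<^sup>2 * B (grid u h (i + 1) - grid u h i)"

definition down_rate :: "(real \<Rightarrow> real) \<Rightarrow> (real \<Rightarrow> real) \<Rightarrow> real \<Rightarrow> int \<Rightarrow> real" where
  "down_rate B u h i = 1 / h\<^sup>2 * B (grid u h (i - 1) - grid u h i)"

definition gibbs :: "(real \<Rightarrow> real) \<Rightarrow> real \<Rightarrow> int \<Rightarrow> real" where
  "gibbs u h i = exp (- grid u h i) / (\<Sum>\<^sub>\<infinity>j. exp (- grid u h j))"

definition pairing :: "(int \<Rightarrow> real) \<Rightarrow> (int \<Rightarrow> real) \<Rightarrow> real" where
  "pairing f g = (\<Sum>\<^sub>\<infinity>i. f i * g i)"

definition fwd_diff :: "(int \<Rightarrow> real) \<Rightarrow> int \<Rightarrow> real" where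
  "fwd_diff f i = f (i + 1) - f i"

definition bwd_diff :: "(int \<Rightarrow> real) \<Rightarrow> int \<Rightarrow> real" where
  "bwd_diff f i = f i - f (i - 1)"

definition carre_du_champ ::
  "(real \<Rightarrow> real) \<Rightarrow> (real \<Rightarrow> real) \<Rightarrow> real \<Rightarrow> (int \<Rightarrow> real) \<Rightarrow> (int \<Rightarrow> real) \<Rightarrow> int \<Rightarrow> real" where
  "carre_du_champ B u h f g i =
     1 / 2 * up_rate B u h i * fwd_diff f i * fwd_diff g i +
     1 / 2 * down_rate B u h i * bwd_diff f i * bwd_diff g i"

definition generator ::
  "(real \<Rightarrow> real) \<Rightarrow> (real \<Rightarrow> real) \<Rightarrow> real \<Rightarrow> (int \<Rightarrow> real) \<Rightarrow> int \<Rightarrow> real" where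
  "generator B u h f i =
     up_rate B u h i * (f (i + 1) - f i) - down_rate B u h i * (f i - f (i - 1))"

text \<open>
  Nonnegative solutions \<open>p t i j\<close> of the Kolmogorov backward equation: for each \<open>j\<close> the
  generator acts on the starting point \<open>i\<close>.  Only times \<open>t \<ge> 0\<close> matter; the derivative at
  \<open>t = 0\<close> is one-sided.
\<close>

definition backward_solution ::
  "(real \<Rightarrow> real) \<Rightarrow> (real \<Rightarrow> real) \<Rightarrow> real \<Rightarrow> (real \<Rightarrow> int \<Rightarrow> int \<Rightarrow> real) \<Rightarrow> bool" where
  "backward_solution B u h p \<longleftrightarrow>
     (\<forall>i j. p 0 i j = (if i = j then 1 else 0)) \<and>
     (\<forall>t\<ge>0. \<forall>i j. 0 \<le> p t i j) \<and>
     (\<forall>t\<ge>0. \<forall>i j.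
        ((\<lambda>s. p s i j) has_real_derivative generator B u h (\<lambda>k. p t k j) i) (at t within {0..}))"

definition minimal_backward_solution ::
  "(real \<Rightarrow> real) \<Rightarrow> (real \<Rightarrow> real) \<Rightarrow> real \<Rightarrow> (real \<Rightarrow> int \<Rightarrow> int \<Rightarrow> real) \<Rightarrow> bool" where
  "minimal_backward_solution B u h p \<longleftrightarrow>
     backward_solution B u h p \<and>
     (\<forall>q. backward_solution B u h q \<longrightarrow> (\<forall>t\<ge>0. \<forall>i j. p t i j \<le> q t i j))"

text \<open>
  A minimal solution exists by Feller's construction, for arbitrary nonnegative rates, and
  minimality determines it at all times \<open>t \<ge> 0\<close>, so the choice below only affects the
  irrelevant values at negative times.
\<close>

definition transition_prob ::
  "(real \<Rightarrow> real) \<Rightarrow> (real \<Rightarrow> real) \<Rightarrow> real \<Rightarrow> real \<Rightarrow> int \<Rightarrow> int \<Rightarrow> real" where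
  "transition_prob B u h = (SOME p. minimal_backward_solution B u h p)"

definition markov_semigroup ::
  "(real \<Rightarrow> real) \<Rightarrow> (real \<Rightarrow> real) \<Rightarrow> real \<Rightarrow> real \<Rightarrow> (int \<Rightarrow> real) \<Rightarrow> int \<Rightarrow> real" where
  "markov_semigroup B u h t f i = (\<Sum>\<^sub>\<infinity>j. f j * transition_prob B u h t i j)"

text \<open>
  \<open>\<langle>(f - \<langle>f, \<pi>\<rangle>)\<^sup>2 + \<Gamma>(f, f), \<pi>\<rangle>\<close>, with the constant \<open>\<langle>f, \<pi>\<rangle>\<close> read as a constant sequence.
  For admissible \<open>B\<close>, uniformly convex \<open>u\<close> and bounded \<open>f\<close> all the series involved converge
  absolutely: \<open>B s \<le> 1\<close> for \<open>s \<ge> 0\<close> and \<open>B (- s) = exp s * B s\<close> give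
  \<open>up_rate B u h i * exp (- grid u h i) \<le> (exp (- grid u h i) + exp (- grid u h (i + 1))) / h\<^sup>2\<close>,
  and similarly for \<open>down_rate\<close>.
\<close>

definition energy ::
  "(real \<Rightarrow> real) \<Rightarrow> (real \<Rightarrow> real) \<Rightarrow> real \<Rightarrow> (int \<Rightarrow> real) \<Rightarrow> real" where
  "energy B u h f =
     pairing (\<lambda>i. (f i - pairing f (gibbs u h))\<^sup>2 + carre_du_champ B u h f f i) (gibbs u h)"

end

theory Submission
  imports Defs
begin

text \<open>
  Along the flow, the increments of \<open>f\<close> satisfy a birth-death equation on the edges, reversible for
  the weight \<open>\<alpha>\<^sub>i \<pi>\<^sub>i\<close>, with killing rate \<open>\<alpha>\<^sub>i - \<alpha>\<^sub>i\<^sub>+\<^sub>1 + \<beta>\<^sub>i\<^sub>+\<^sub>1 - \<beta>\<^sub>i\<close>.  Convexity of \<open>B\<close>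
  and \<open>u\<close> bounds this rate below by some \<open>\<kappa> > 0\<close> uniformly in \<open>i\<close> and \<open>h\<close>, so the Dirichlet form \<open>E\<close>
  decays at rate \<open>2\<kappa>\<close>.  Since the variance \<open>V\<close> has derivative \<open>- 2E\<close>, the quantity \<open>E - \<kappa> V\<close> is
  nonincreasing with limit \<open>0\<close>, which is the Poincare inequality \<open>\<kappa> V \<le> E\<close>; hence \<open>V + E\<close> decays at
  rate \<open>2\<kappa>\<close>.

  To justify this for unbounded rates, everything is done for the chain reflected at \<open>\<plusminus>n\<close>, which
  preserves reversibility and the curvature bound.  The maximum principle with the Lyapunov
  function \<open>\<bar>i\<bar>\<close> shows that the reflected flows are Cauchy, that their limit is the only bounded
  solution of the backward equation, and that any nonnegative bounded solution is the minimal one.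
\<close>

section \<open>The maximum principle for birth-death generators\<close>

definition bd_gen :: "(int \<Rightarrow> real) \<Rightarrow> (int \<Rightarrow> real) \<Rightarrow> (int \<Rightarrow> real) \<Rightarrow> int \<Rightarrow> real" where
  "bd_gen a b f i = a i * (f (i + 1) - f i) - b i * (f i - f (i - 1))"

lemma generator_eq_bd_gen: "generator B u h = bd_gen (up_rate B u h) (down_rate B u h)"
  by (intro ext) (simp add: generator_def bd_gen_def)

lemma bd_gen_add: "bd_gen a b (\<lambda>j. f j + g j) i = bd_gen a b f i + bd_gen a b g i"
  by (simp add: bd_gen_def algebra_simps)

lemma bd_gen_diff: "bd_gen a b (\<lambda>j. f j - g j) i = bd_gen a b f i - bd_gen a b g i"
  by (simp add: bd_gen_def algebra_simps)

lemma bd_gen_minus: "bd_gen a b (\<lambda>j. - f j) i = - bd_gen a b f i"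
  by (simp add: bd_gen_def algebra_simps)

lemma bd_gen_cmult: "bd_gen a b (\<lambda>j. c * f j) i = c * bd_gen a b f i"
  by (simp add: bd_gen_def algebra_simps)

lemma bd_gen_const [simp]: "bd_gen a b (\<lambda>j. c) i = 0"
  by (simp add: bd_gen_def)

lemma bd_gen_sum: "bd_gen a b (\<lambda>j. \<Sum>k\<in>A. F k j) i = (\<Sum>k\<in>A. bd_gen a b (F k) i)"
  by (induction A rule: infinite_finite_induct) (simp_all add: bd_gen_add)

text \<open>
  The comparison function \<open>\<bar>i\<bar> + (C + 1) * t\<close> is a strict supersolution, so a negative minimum
  of the perturbed solution over the finite box would have a positive time derivative.
\<close>

lemma bd_barrier:
  fixes w :: "real \<Rightarrow> int \<Rightarrow> real" and N :: int
  assumes a: "\<And>i. a i \<ge> 0" and b: "\<And>i. b i \<ge> 0" and N: "N > 0" and M: "M > 0" and C: "C \<ge> 0"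
    and lyap: "\<And>i. \<bar>i\<bar> \<le> N \<Longrightarrow> bd_gen a b (\<lambda>j. \<bar>real_of_int j\<bar>) i \<le> C"
    and der: "\<And>t i. t \<ge> 0 \<Longrightarrow> \<bar>i\<bar> \<le> N \<Longrightarrow>
               ((\<lambda>s. w s i) has_real_derivative bd_gen a b (w t) i) (at t within {0..})"
    and low: "\<And>t i. t \<ge> 0 \<Longrightarrow> - M \<le> w t i"
    and init: "\<And>i. \<bar>i\<bar> \<le> N \<Longrightarrow> - (M / N * \<bar>real_of_int i\<bar>) \<le> w 0 i"
    and T: "T \<ge> 0"
  shows "- (M / N * (\<bar>real_of_int i\<bar> + (C + 1) * T)) \<le> w T i"
proof -
  define S where "S = {-N..N}"
  define v where "v s i = w s i + M / N * (\<bar>real_of_int i\<bar> + (C + 1) * s)" for s i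
  have MN: "M / N > 0" using M N by simp
  have S: "finite S" "S \<noteq> {}" "i \<in> S \<longleftrightarrow> \<bar>i\<bar> \<le> N" for i
    using N by (auto simp: S_def)
  \<comment> \<open>Beyond the box the spatial part of the barrier is at least \<open>M\<close> and
    offsets the lower bound on \<open>w\<close>.\<close>
  have out: "v s i \<ge> 0" if "s \<ge> 0" "i \<notin> S" for s i
  proof -
    have "real_of_int N \<le> \<bar>real_of_int i\<bar> + (C + 1) * s"
    proof -
      have "N < \<bar>i\<bar>" using that S by auto
      then have "real_of_int N \<le> \<bar>real_of_int i\<bar>" by linarith
      moreover have "(C + 1) * s \<ge> 0" using C that by simp
      ultimately show ?thesis by linarith
    qed
    then have "M / N * N \<le> M / N * (\<bar>real_of_int i\<bar> + (C + 1) * s)"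
      using MN by (intro mult_left_mono) auto
    then have "M \<le> M / N * (\<bar>real_of_int i\<bar> + (C + 1) * s)"
      using N by simp
    then show ?thesis using low[OF that(1), of i] by (simp add: v_def)
  qed
  have vder: "((\<lambda>s. v s i) has_real_derivative bd_gen a b (w t) i + M / N * (C + 1)) (at t within {0..})"
    if "t \<ge> 0" "i \<in> S" for t i
    unfolding v_def by (rule derivative_eq_intros der refl | use that S in force)+
  have "\<exists>\<tau>. \<tau> \<in> {0..T} \<and> (\<forall>s\<in>{0..T}. v \<tau> i \<le> v s i)" if "i \<in> S" for i
  proof -
    have "continuous_on {0..T} (\<lambda>s. v s i)"
      by (rule DERIV_continuous_on[OF DERIV_subset[OF vder[OF _ that]]]) auto
    then show ?thesis
      using continuous_attains_inf[of "{0..T}" "\<lambda>s. v s i"] T by auto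
  qed
  then obtain \<tau> where \<tau>: "\<And>i. i \<in> S \<Longrightarrow> \<tau> i \<in> {0..T}"
    "\<And>i s. i \<in> S \<Longrightarrow> s \<in> {0..T} \<Longrightarrow> v (\<tau> i) i \<le> v s i"
    by metis
  obtain k where k: "k \<in> S" "\<And>i. i \<in> S \<Longrightarrow> v (\<tau> k) k \<le> v (\<tau> i) i"
    using ex_is_arg_min_if_finite[OF S(1,2), of "\<lambda>i. v (\<tau> i) i"]
    unfolding is_arg_min_linorder by auto
  have kmin: "v (\<tau> k) k \<le> v s i" if "s \<in> {0..T}" "i \<in> S" for s i
    using order_trans[OF k(2) \<tau>(2)] that by blast
  have "v (\<tau> k) k \<ge> 0"
  proof (rule ccontr)
    assume neg: "\<not> ?thesis"
    define t where "t = \<tau> k"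
    have t: "t \<in> {0..T}" using \<tau> k t_def by auto
    have "v 0 k \<ge> 0" using init[of k] k S by (simp add: v_def)
    then have tpos: "t > 0" using neg t by (cases "t = 0") (auto simp: t_def)
    \<comment> \<open>The value at \<open>k\<close> is negative while \<open>v\<close> is
      nonnegative outside the box, so the comparison also covers neighbours beyond its edge.\<close>
    have min: "v t k \<le> v t i" for i
      using out[of t i] kmin[of t i] neg t t_def by fastforce
    have "0 \<le> bd_gen a b (v t) k"
    proof -
      have "a k * (v t (k + 1) - v t k) \<ge> 0" "b k * (v t (k - 1) - v t k) \<ge> 0"
        using a b min by (simp_all)
      then show ?thesis unfolding bd_gen_def by (simp add: algebra_simps)
    qed
    also have "bd_gen a b (v t) k = bd_gen a b (w t) k + M / N * bd_gen a b (\<lambda>j. \<bar>real_of_int j\<bar>) k"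
      by (simp only: v_def[abs_def] bd_gen_add bd_gen_cmult bd_gen_const mult_zero_right add_0_right)
    also have "\<dots> \<le> bd_gen a b (w t) k + M / N * C"
      using lyap[of k] k S MN by (intro add_left_mono mult_left_mono) auto
    finally have "bd_gen a b (w t) k + M / N * (C + 1) > 0" using MN by (simp add: ring_distribs)
    from has_real_derivative_pos_inc_left[OF vder this, of] t k
    obtain d where d: "d > 0" "\<And>h. h > 0 \<Longrightarrow> t - h \<in> {0..} \<Longrightarrow> h < d \<Longrightarrow> v (t - h) k < v t k"
      by auto
    define h where "h = min (d/2) t"
    have "v (t - h) k < v t k" using d tpos by (intro d(2)) (auto simp: h_def)
    moreover have "v t k \<le> v (t - h) k"
      using kmin[of "t - h" k] k t tpos d by (auto simp: h_def t_def)
    ultimately show False by simp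
  qed
  then have "v T i \<ge> 0"
    using kmin[of T i] out[of T i] T by (cases "i \<in> S") auto
  then show ?thesis by (simp add: v_def)
qed

lemma bd_barrier_abs:
  fixes w :: "real \<Rightarrow> int \<Rightarrow> real" and N :: int
  assumes "\<And>i. a i \<ge> 0" and "\<And>i. b i \<ge> 0" and "N > 0" and "M > 0" and "C \<ge> 0"
    and "\<And>i. \<bar>i\<bar> \<le> N \<Longrightarrow> bd_gen a b (\<lambda>j. \<bar>real_of_int j\<bar>) i \<le> C"
    and der: "\<And>t i. t \<ge> 0 \<Longrightarrow> \<bar>i\<bar> \<le> N \<Longrightarrow>
               ((\<lambda>s. w s i) has_real_derivative bd_gen a b (w t) i) (at t within {0..})"
    and low: "\<And>t i. t \<ge> 0 \<Longrightarrow> \<bar>w t i\<bar> \<le> M"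
    and init: "\<And>i. \<bar>i\<bar> \<le> N \<Longrightarrow> \<bar>w 0 i\<bar> \<le> M / N * \<bar>real_of_int i\<bar>"
    and "T \<ge> 0"
  shows "\<bar>w T i\<bar> \<le> M / N * (\<bar>real_of_int i\<bar> + (C + 1) * T)"
proof -
  have "- (M / N * (\<bar>real_of_int i\<bar> + (C + 1) * T)) \<le> w T i"
    using assms by (intro bd_barrier[where a = a and b = b]) (auto simp: abs_le_iff minus_le_iff)
  moreover have "- (M / N * (\<bar>real_of_int i\<bar> + (C + 1) * T)) \<le> - w T i"
    using assms
    by (intro bd_barrier[where a = a and b = b and w = "\<lambda>t i. - w t i"])
       (auto simp: abs_le_iff bd_gen_minus intro!: derivative_intros)
  ultimately show ?thesis by linarith
qed

text \<open>On the box \<open>{-N..N}\<close> the barrier at a fixed point has size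
  \<open>O(1/N)\<close>; letting \<open>N\<close> grow leaves no negative part. Solutions unbounded
  above are covered.\<close>

lemma bd_nonneg:
  fixes w :: "real \<Rightarrow> int \<Rightarrow> real"
  assumes a: "\<And>i. a i \<ge> 0" and b: "\<And>i. b i \<ge> 0" and C: "C \<ge> 0"
    and lyap: "\<And>i. bd_gen a b (\<lambda>j. \<bar>real_of_int j\<bar>) i \<le> C"
    and der: "\<And>t i. t \<ge> 0 \<Longrightarrow>
               ((\<lambda>s. w s i) has_real_derivative bd_gen a b (w t) i) (at t within {0..})"
    and low: "\<And>t i. t \<ge> 0 \<Longrightarrow> - M \<le> w t i"
    and init: "\<And>i. 0 \<le> w 0 i"
    and T: "T \<ge> 0"
  shows "0 \<le> w T i"
proof -
  define M' where "M' = max M 1"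
  have "- (M' / real n * (\<bar>real_of_int i\<bar> + (C + 1) * T)) \<le> w T i" if "n > 0" for n :: nat
  proof -
    have "- (M' / real_of_int (int n) * (\<bar>real_of_int i\<bar> + (C + 1) * T)) \<le> w T i"
    proof (rule bd_barrier[OF a b _ _ C lyap der _ _ T])
      show "- M' \<le> w t i" if "t \<ge> 0" for t i using low[OF that, of i] by (simp add: M'_def)
      show "- (M' / real_of_int (int n) * \<bar>real_of_int i\<bar>) \<le> w 0 i" for i
        using init[of i] by (smt (verit) M'_def divide_nonneg_nonneg mult_nonneg_nonneg of_int_of_nat_eq of_nat_0_le_iff abs_ge_zero)
    qed (use that in \<open>auto simp: M'_def\<close>)
    then show ?thesis by simp
  qed
  then have "\<forall>\<^sub>F n in sequentially. - (M' / real n * (\<bar>real_of_int i\<bar> + (C + 1) * T)) \<le> w T i"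
    by (intro eventually_mono[OF eventually_gt_at_top[of "0::nat"]])
  moreover have "(\<lambda>n. - (M' / real n * (\<bar>real_of_int i\<bar> + (C + 1) * T))) \<longlonglongrightarrow> - (0 * (\<bar>real_of_int i\<bar> + (C + 1) * T))"
    by (intro tendsto_intros lim_const_over_n)
  ultimately show ?thesis
    using tendsto_upperbound[of _ _ sequentially "w T i"] by fastforce
qed

section \<open>Bounded flows, and their existence for bounded rates\<close>

definition bd_flow :: "(int \<Rightarrow> real) \<Rightarrow> (int \<Rightarrow> real) \<Rightarrow> real \<Rightarrow> (int \<Rightarrow> real) \<Rightarrow> (real \<Rightarrow> int \<Rightarrow> real) \<Rightarrow> bool"
  where "bd_flow a b M f U \<longleftrightarrow>
    U 0 = f \<and> (\<forall>t\<ge>0. \<forall>i. \<bar>U t i\<bar> \<le> M) \<and>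
    (\<forall>t\<ge>0. \<forall>i. ((\<lambda>s. U s i) has_real_derivative bd_gen a b (U t) i) (at t within {0..}))"

text \<open>Uniformization: \<open>J\<close>, the identity plus the generator divided by
  \<open>c\<close>, averages with nonnegative weights of sum \<open>1\<close>. The solution is
  \<open>exp (- c * t)\<close> times the series of \<open>(c * t) ^ n / fact n\<close> times the
  \<open>n\<close>-th iterate of \<open>J\<close> on \<open>f\<close>. This Poisson mixture keeps
  the bound \<open>M\<close>.\<close>

lemma bd_flow_bounded_rates:
  assumes a: "\<And>i. 0 \<le> a i" "\<And>i. a i \<le> K" and b: "\<And>i. 0 \<le> b i" "\<And>i. b i \<le> K"
    and f: "\<And>i. \<bar>f i\<bar> \<le> M"
  shows "\<exists>U. bd_flow a b M f U"
proof -
  \<comment> \<open>The total jump rate is at most \<open>2 * K\<close>; the extra \<open>1\<close>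
    keeps \<open>c\<close> positive when \<open>K = 0\<close>.\<close>
  define c where "c = 2 * K + 1"
  have K: "K \<ge> 0" using a(1,2)[of 0] by linarith
  then have c: "c > 0" by (simp add: c_def)
  define J where "J g i = g i + bd_gen a b g i / c" for g i
  have J_eq: "J g i = (1 - (a i + b i) / c) * g i + a i / c * g (i + 1) + b i / c * g (i - 1)" for g i
    using c by (simp add: J_def bd_gen_def field_simps)
  have J_bound: "\<bar>J g i\<bar> \<le> M" if g: "\<And>j. \<bar>g j\<bar> \<le> M" for g i
  proof -
    have coef: "1 - (a i + b i) / c \<ge> 0" "a i / c \<ge> 0" "b i / c \<ge> 0"
      using a[of i] b[of i] c by (auto simp: c_def field_simps)
    have "\<bar>J g i\<bar> \<le> (1 - (a i + b i) / c) * \<bar>g i\<bar> + a i / c * \<bar>g (i + 1)\<bar> + b i / c * \<bar>g (i - 1)\<bar>"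
      unfolding J_eq using coef
      by (intro order_trans[OF abs_triangle_ineq] add_mono) (simp_all add: abs_mult a b c less_imp_le)
    also have "\<dots> \<le> (1 - (a i + b i) / c) * M + a i / c * M + b i / c * M"
      using coef g by (intro add_mono mult_left_mono) auto
    also have "\<dots> = M" by (simp add: field_simps add_divide_distrib)
    finally show ?thesis .
  qed
  define F where "F n = (J ^^ n) f" for n
  have F_bound: "\<bar>F n i\<bar> \<le> M" for n i
    unfolding F_def by (induction n arbitrary: i) (simp_all add: f J_bound)
  define q where "q i n = F n i * c ^ n / fact n" for i n
  have q_le: "norm (q i n * x ^ n) \<le> M * (inverse (fact n) * \<bar>c * x\<bar> ^ n)" for i n x
  proof -
    have "norm (q i n * x ^ n) = \<bar>F n i\<bar> * (inverse (fact n) * \<bar>c * x\<bar> ^ n)"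
      by (simp add: q_def abs_mult power_mult_distrib power_abs field_simps)
    also have "\<dots> \<le> M * (inverse (fact n) * \<bar>c * x\<bar> ^ n)"
      using F_bound by (intro mult_right_mono) auto
    finally show ?thesis .
  qed
  have sq_maj: "summable (\<lambda>n. M * (inverse (fact n) * \<bar>c * x\<bar> ^ n))" for x :: real
    by (intro summable_mult summable_exp)
  have sq: "summable (\<lambda>n. q i n * x ^ n)" for i x
    by (rule summable_comparison_test'[OF sq_maj q_le])
  define G where "G t i = (\<Sum>n. q i n * t ^ n)" for t i
  have diffs_q: "diffs (q i) n = c * ((1 - (a i + b i) / c) * q i n + a i / c * q (i + 1) n + b i / c * q (i - 1) n)" for i n
  proof -
    have "diffs (q i) n = c * (J (F n) i * c ^ n / fact n)"
      by (simp add: diffs_def q_def F_def)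
    then show ?thesis by (simp add: J_eq q_def field_simps)
  qed
  have G_der: "((\<lambda>t. G t i) has_real_derivative c * G t i + bd_gen a b (G t) i) (at t)" for t i
  proof -
    have "((\<lambda>t. G t i) has_real_derivative (\<Sum>n. diffs (q i) n * t ^ n)) (at t)"
      unfolding G_def by (rule termdiffs_strong_converges_everywhere[OF sq])
    also have "(\<Sum>n. diffs (q i) n * t ^ n) = (\<Sum>n. c * ((1 - (a i + b i) / c) * (q i n * t ^ n) + a i / c * (q (i + 1) n * t ^ n) + b i / c * (q (i - 1) n * t ^ n)))"
      by (intro suminf_cong, unfold diffs_q) (simp only: ring_distribs mult.assoc)
    also have "\<dots> = c * ((1 - (a i + b i) / c) * G t i + a i / c * G t (i + 1) + b i / c * G t (i - 1))"
      unfolding G_def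
      by (intro sums_unique[symmetric] sums_mult sums_add summable_sums sq)
    also have "\<dots> = c * G t i + bd_gen a b (G t) i"
      using c by (simp add: bd_gen_def field_simps)
    finally show ?thesis .
  qed
  define U where "U t i = exp (- c * t) * G t i" for t i
  have "((\<lambda>s. U s i) has_real_derivative bd_gen a b (U t) i) (at t within {0..})" for t i
  proof -
    have "((\<lambda>s. U s i) has_real_derivative exp (- c * t) * (- c) * G t i + (c * G t i + bd_gen a b (G t) i) * exp (- c * t)) (at t)"
      unfolding U_def by (rule derivative_eq_intros G_der refl | simp)+
    also have "exp (- c * t) * (- c) * G t i + (c * G t i + bd_gen a b (G t) i) * exp (- c * t) = bd_gen a b (U t) i"
      by (simp add: U_def[abs_def] bd_gen_def algebra_simps)
    finally show ?thesis by (rule has_field_derivative_at_within)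
  qed
  moreover have "\<bar>U t i\<bar> \<le> M" if "t \<ge> 0" for t i
  proof -
    have sn: "summable (\<lambda>n. norm (q i n * t ^ n))"
      by (rule summable_comparison_test'[OF sq_maj, where N = 0]) (use q_le in simp)
    have "\<bar>G t i\<bar> \<le> (\<Sum>n. norm (q i n * t ^ n))"
      unfolding G_def using summable_norm[OF sn] by simp
    also have "\<dots> \<le> (\<Sum>n. M * (inverse (fact n) * \<bar>c * t\<bar> ^ n))"
      by (intro suminf_le q_le sn sq_maj)
    also have "\<dots> = M * exp (c * t)"
      using c that suminf_mult[OF summable_exp[of "\<bar>c * t\<bar>"], of M] by (simp add: exp_def)
    finally have "\<bar>U t i\<bar> \<le> exp (- c * t) * (M * exp (c * t))"
      unfolding U_def abs_mult by (simp add: mult_left_mono)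
    then show ?thesis by (simp add: exp_minus field_simps)
  qed
  moreover have "U 0 = f"
    unfolding U_def G_def powser_zero by (simp add: q_def F_def fun_eq_iff)
  ultimately show ?thesis unfolding bd_flow_def by blast
qed

section \<open>Construction of the semigroup\<close>

text \<open>With \<open>trunc_down\<close>, this removes the jumps out of the box and freezes the
  points outside it. Both directions of an edge are kept or dropped together, so detailed balance
  survives.\<close>

definition trunc_up :: "(int \<Rightarrow> real) \<Rightarrow> nat \<Rightarrow> int \<Rightarrow> real" where
  "trunc_up a n i = (if - int n \<le> i \<and> i < int n then a i else 0)"

definition trunc_down :: "(int \<Rightarrow> real) \<Rightarrow> nat \<Rightarrow> int \<Rightarrow> real" where
  "trunc_down b n i = (if - int n < i \<and> i \<le> int n then b i else 0)"

lemma bd_gen_trunc: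
  "\<bar>i\<bar> < int n \<Longrightarrow> bd_gen (trunc_up a n) (trunc_down b n) f i = bd_gen a b f i"
  by (auto simp: bd_gen_def trunc_up_def trunc_down_def)

lemma bd_flow_trunc_exists:
  assumes a: "\<And>i. 0 \<le> a i" and b: "\<And>i. 0 \<le> b i" and f: "\<And>i. \<bar>f i\<bar> \<le> M"
  shows "\<exists>U. bd_flow (trunc_up a n) (trunc_down b n) M f U"
proof -
  define K where "K = (\<Sum>i\<in>{-int n..int n}. a i + b i)"
  have K: "a i + b i \<le> K" if "i \<in> {-int n..int n}" for i
    unfolding K_def by (rule member_le_sum) (use that a b in auto)
  have "K \<ge> 0" unfolding K_def by (intro sum_nonneg add_nonneg_nonneg a b)
  have "a i \<le> K" "b i \<le> K" if "i \<in> {-int n..int n}" for i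
    using K[OF that] a[of i] b[of i] by linarith+
  then show ?thesis
    using \<open>K \<ge> 0\<close> by (intro bd_flow_bounded_rates[where K = K] f) (auto simp: trunc_up_def trunc_down_def a b)
qed

lemma has_sum_int_symmetric:
  assumes "((f :: int \<Rightarrow> real) has_sum x) UNIV"
  shows "(\<lambda>n. \<Sum>i\<in>{- int n..int n}. f i) \<longlonglongrightarrow> x"
proof -
  have "filterlim (\<lambda>n. {- int n..int n}) (finite_subsets_at_top UNIV) sequentially"
    unfolding filterlim_iff eventually_finite_subsets_at_top
  proof (intro allI impI, elim exE conjE)
    fix P and X :: "int set" assume X: "finite X" "\<forall>Y. finite Y \<and> X \<subseteq> Y \<and> Y \<subseteq> UNIV \<longrightarrow> P Y"
    \<comment> \<open>The sum of absolute values is a crude bound for every member of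
      \<open>X\<close>, and it needs no case for the empty set.\<close>
    have "X \<subseteq> {- int n..int n}" if "n \<ge> (\<Sum>x\<in>X. nat \<bar>x\<bar>)" for n
    proof
      fix x assume "x \<in> X"
      then have "nat \<bar>x\<bar> \<le> (\<Sum>x\<in>X. nat \<bar>x\<bar>)" using X by (intro member_le_sum) auto
      then show "x \<in> {- int n..int n}" using that by auto
    qed
    then show "\<forall>\<^sub>F n in sequentially. P {- int n..int n}"
      using X by (intro eventually_sequentiallyI[of "\<Sum>x\<in>X. nat \<bar>x\<bar>"]) auto
  qed
  with assms show ?thesis unfolding has_sum_def by (rule filterlim_compose)
qed

section \<open>Limit of the reflected flows\<close>

locale bd_chain =
  fixes a b :: "int \<Rightarrow> real" and C :: real
  assumes a_nonneg: "0 \<le> a i" and b_nonneg: "0 \<le> b i" and C_nonneg: "0 \<le> C"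
    and lyapunov: "bd_gen a b (\<lambda>j. \<bar>real_of_int j\<bar>) i \<le> C"
begin

text \<open>Strictly inside both boxes neither truncation is visible: on \<open>{-N..N}\<close> the
  difference solves the original equation with zero initial data, so the barrier applies. The
  \<open>+ 1\<close> makes its constant positive.\<close>

lemma trunc_flow_cauchy_bound:
  assumes "bd_flow (trunc_up a n) (trunc_down b n) M f U"
    and "bd_flow (trunc_up a m) (trunc_down b m) M f V"
    and "0 < N" "N < n" "N < m" "0 \<le> t"
  shows "\<bar>U t i - V t i\<bar> \<le> (2 * \<bar>M\<bar> + 1) / N * (\<bar>real_of_int i\<bar> + (C + 1) * t)"
proof -
  have "\<bar>U t i - V t i\<bar> \<le> (2 * \<bar>M\<bar> + 1) / real_of_int (int N) * (\<bar>real_of_int i\<bar> + (C + 1) * t)"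
  proof (rule bd_barrier_abs[where a = a and b = b and w = "\<lambda>t i. U t i - V t i"])
    show "((\<lambda>s. U s i - V s i) has_real_derivative bd_gen a b (\<lambda>i. U t i - V t i) i) (at t within {0..})"
      if "t \<ge> 0" "\<bar>i\<bar> \<le> int N" for t i
    proof -
      have "\<bar>i\<bar> < int n" "\<bar>i\<bar> < int m" using that assms by linarith+
      then have "((\<lambda>s. U s i) has_real_derivative bd_gen a b (U t) i) (at t within {0..})"
        "((\<lambda>s. V s i) has_real_derivative bd_gen a b (V t) i) (at t within {0..})"
        using assms(1,2) \<open>t \<ge> 0\<close> unfolding bd_flow_def by (metis bd_gen_trunc)+
      then show ?thesis unfolding bd_gen_diff by (rule DERIV_diff)
    qed
    show "\<bar>U t i - V t i\<bar> \<le> 2 * \<bar>M\<bar> + 1" if "t \<ge> 0" for t i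
    proof -
      have "\<bar>U t i\<bar> \<le> M" "\<bar>V t i\<bar> \<le> M"
        using assms that unfolding bd_flow_def by auto
      then show ?thesis by linarith
    qed
    show "\<bar>U 0 i - V 0 i\<bar> \<le> (2 * \<bar>M\<bar> + 1) / real_of_int (int N) * \<bar>real_of_int i\<bar>" for i
      using assms unfolding bd_flow_def by simp
  qed (use assms in \<open>auto simp: a_nonneg b_nonneg C_nonneg lyapunov\<close>)
  then show ?thesis by simp
qed

text \<open>The Cauchy bound is uniform for \<open>t\<close> in compact intervals. At fixed
  \<open>i\<close> the generator involves only three values, so the time derivatives also converge
  uniformly and the limit can be differentiated.\<close>

theorem trunc_flow_converges:
  assumes flow: "\<And>n. bd_flow (trunc_up a n) (trunc_down b n) M f (U n)"
  obtains V where "bd_flow a b M f V" "\<And>t i. 0 \<le> t \<Longrightarrow> (\<lambda>n. U n t i) \<longlonglongrightarrow> V t i"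
proof -
  define R where "R i t = (2 * \<bar>M\<bar> + 1) * (\<bar>real_of_int i\<bar> + (C + 1) * t)" for i t
  have R_nonneg: "R i t \<ge> 0" if "t \<ge> 0" for i t
    using that C_nonneg by (simp add: R_def)
  have R_mono: "R i t \<le> R i T" if "t \<le> T" for i t T
    using that C_nonneg by (simp add: R_def mult_left_mono)
  have close: "\<bar>U n t i - U m t i\<bar> \<le> R i t / N" if "0 < N" "N < n" "N < m" "0 \<le> t" for n m N t i
    using trunc_flow_cauchy_bound[OF flow flow that, of i] by (simp add: R_def)
  have small: "\<exists>N>0. R i t / real N < e" if "e > 0" for i t e
  proof -
    have "(\<lambda>n. R i t / real n) \<longlonglongrightarrow> 0" by (rule lim_const_over_n)
    then have "\<forall>\<^sub>F n in sequentially. R i t / real n < e \<and> n > 0"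
      using that by (intro eventually_conj order_tendstoD(2) eventually_gt_at_top)
    from eventually_happens'[OF _ this] show ?thesis by auto
  qed
  define V where "V t i = (if t \<ge> 0 then lim (\<lambda>n. U n t i) else 0)" for t i
  have conv: "(\<lambda>n. U n t i) \<longlonglongrightarrow> V t i" if "t \<ge> 0" for t i
  proof -
    have "Cauchy (\<lambda>n. U n t i)"
    proof (rule metric_CauchyI)
      fix e :: real assume "e > 0"
      then obtain N where "N > 0" "R i t / real N < e" using small by blast
      then show "\<exists>N. \<forall>m\<ge>N. \<forall>n\<ge>N. dist (U m t i) (U n t i) < e"
        using close[of N _ _ t i] that
        by (intro exI[of _ "Suc N"]) (force simp: dist_real_def Suc_le_eq)
    qed
    then show ?thesis
      using that by (simp add: V_def Cauchy_convergent_iff convergent_LIMSEQ_iff)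
  qed
  have close_V: "\<bar>U n t i - V t i\<bar> \<le> R i t / N" if "0 < N" "N < n" "0 \<le> t" for n N t i
  proof (rule tendsto_upperbound)
    show "(\<lambda>m. \<bar>U n t i - U m t i\<bar>) \<longlonglongrightarrow> \<bar>U n t i - V t i\<bar>"
      by (intro tendsto_intros conv that)
    show "\<forall>\<^sub>F m in sequentially. \<bar>U n t i - U m t i\<bar> \<le> R i t / N"
      using eventually_gt_at_top[of N] by eventually_elim (use close that in auto)
  qed simp
  have unif: "uniform_limit {0..T} (\<lambda>n t. U n t i) (\<lambda>t. V t i) sequentially" for T i
  proof (rule uniform_limitI)
    fix e :: real assume "e > 0"
    then obtain N where N: "N > 0" "R i T / real N < e" using small by blast
    show "\<forall>\<^sub>F n in sequentially. \<forall>x\<in>{0..T}. dist (U n x i) (V x i) < e"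
      using eventually_gt_at_top[of N]
    proof eventually_elim
      case (elim n)
      show ?case
      proof
        fix x assume x: "x \<in> {0..T}"
        have "\<bar>U n x i - V x i\<bar> \<le> R i x / N" using close_V elim N x by simp
        also have "\<dots> \<le> R i T / N" using R_mono x N by (intro divide_right_mono) auto
        finally show "dist (U n x i) (V x i) < e" using N by (simp add: dist_real_def)
      qed
    qed
  qed
  have der: "((\<lambda>s. V s i) has_real_derivative bd_gen a b (V t) i) (at t within {0..})" if t: "t \<ge> 0" for t i
  proof -
    \<comment> \<open>The margin keeps \<open>t\<close> off the right end, so derivatives within
      \<open>{0..T}\<close> and within \<open>{0..}\<close> agree there.\<close>
    define T where "T = t + 1"
    define g where "g n s = bd_gen (trunc_up a n) (trunc_down b n) (U n s) i" for n s
    have T: "T > 0" "t < T" using t by (auto simp: T_def)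
    have "uniform_limit {0..T} (\<lambda>n s. bd_gen a b (U n s) i) (\<lambda>s. bd_gen a b (V s) i) sequentially"
      unfolding bd_gen_def by (intro uniform_limit_intros bounded_linear_uniform_limit_intros unif)
    moreover have "\<forall>\<^sub>F n in sequentially. \<forall>s\<in>{0..T}. bd_gen a b (U n s) i = g n s"
      using eventually_gt_at_top[of "nat \<bar>i\<bar>"]
      by eventually_elim (auto simp: g_def bd_gen_trunc nat_less_iff)
    ultimately have ul: "uniform_limit {0..T} g (\<lambda>s. bd_gen a b (V s) i) sequentially"
      by (rule uniform_limit_cong[THEN iffD1, rotated -1]) auto
    have "\<exists>G. \<forall>x\<in>{0..T}. (\<lambda>n. U n x i) \<longlonglongrightarrow> G x \<and>
        (G has_derivative (\<lambda>h. bd_gen a b (V x) i * h)) (at x within {0..T})"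
    proof (rule has_derivative_sequence[where f' = "\<lambda>n x h. g n x * h" and ?x0.0 = 0 and l = "V 0 i"])
      show "((\<lambda>x. U n x i) has_derivative (\<lambda>h. g n x * h)) (at x within {0..T})" if "x \<in> {0..T}" for n x
      proof -
        have "((\<lambda>x. U n x i) has_real_derivative g n x) (at x within {0..})"
          using flow[of n] that unfolding bd_flow_def g_def by auto
        then have "((\<lambda>x. U n x i) has_real_derivative g n x) (at x within {0..T})"
          by (rule DERIV_subset) auto
        then show ?thesis by (simp add: has_field_derivative_def)
      qed
      show "\<forall>\<^sub>F n in sequentially. \<forall>x\<in>{0..T}. \<forall>h. norm (g n x * h - bd_gen a b (V x) i * h) \<le> e * norm h"
        if "e > 0" for e
        using uniform_limitD[OF ul that]
      proof eventually_elim
        case (elim n)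
        then show ?case
          by (auto simp: dist_real_def abs_mult left_diff_distrib[symmetric] less_imp_le intro!: mult_right_mono)
      qed
    qed (use T conv in auto)
    then obtain G where G: "\<And>x. x \<in> {0..T} \<Longrightarrow> (\<lambda>n. U n x i) \<longlonglongrightarrow> G x"
      "\<And>x. x \<in> {0..T} \<Longrightarrow> (G has_real_derivative bd_gen a b (V x) i) (at x within {0..T})"
      unfolding has_field_derivative_def by blast
    have "G x = V x i" if "x \<in> {0..T}" for x
      using LIMSEQ_unique[OF G(1)[OF that] conv] that by simp
    then have "((\<lambda>s. V s i) has_real_derivative bd_gen a b (V t) i) (at t within {0..T})"
      using G(2)[of t] t T by (subst has_field_derivative_cong_eventually[of _ G])
        (auto simp: eventually_at_filter)
    also have "at t within {0..T} = at t within {0..}"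
      by (rule at_within_nhd[of _ "{..<T}"]) (use T in auto)
    finally show ?thesis .
  qed
  have "V 0 i = f i" for i
    using LIMSEQ_unique[OF conv[of 0 i], of "f i"] flow by (simp add: bd_flow_def)
  moreover have "\<bar>V t i\<bar> \<le> M" if "t \<ge> 0" for t i
    using tendsto_upperbound[OF tendsto_rabs[OF conv[OF that, of i]], of M] flow that
    by (simp add: bd_flow_def)
  ultimately have "bd_flow a b M f V" using der by (auto simp: bd_flow_def)
  with conv that show thesis by blast
qed

lemma bd_flow_exists:
  assumes "\<And>i. \<bar>f i\<bar> \<le> M"
  shows "\<exists>V. bd_flow a b M f V"
proof -
  have "\<forall>n. \<exists>U. bd_flow (trunc_up a n) (trunc_down b n) M f U"
    using bd_flow_trunc_exists[of a b f M] a_nonneg b_nonneg assms by simp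
  then obtain U where "\<And>n. bd_flow (trunc_up a n) (trunc_down b n) M f (U n)" by metis
  then show ?thesis by (rule trunc_flow_converges) (rule exI)
qed

text \<open>Since \<open>q\<close> is nonnegative and \<open>p\<close> is bounded,
  \<open>q - p\<close> is bounded below, which the maximum principle requires. This gives minimality
  of the kernel among all nonnegative solutions, bounded or not.\<close>

lemma bd_flow_le:
  assumes p: "bd_flow a b M f p"
    and der: "\<And>t i. t \<ge> 0 \<Longrightarrow> ((\<lambda>s. q s i) has_real_derivative bd_gen a b (q t) i) (at t within {0..})"
    and nonneg: "\<And>t i. t \<ge> 0 \<Longrightarrow> 0 \<le> q t i"
    and init: "\<And>i. f i \<le> q 0 i"
    and t: "t \<ge> 0"
  shows "p t i \<le> q t i"
proof -
  have "0 \<le> q t i - p t i"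
  proof (rule bd_nonneg[OF a_nonneg b_nonneg C_nonneg lyapunov, where w = "\<lambda>t i. q t i - p t i"])
    show "((\<lambda>s. q s i - p s i) has_real_derivative bd_gen a b (\<lambda>i. q t i - p t i) i) (at t within {0..})"
      if "t \<ge> 0" for t i
      using p der that by (auto simp: bd_flow_def bd_gen_diff intro!: derivative_intros)
    show "- M \<le> q t i - p t i" if "t \<ge> 0" for t i
    proof -
      have "\<bar>p t i\<bar> \<le> M" using p that by (simp add: bd_flow_def)
      then show ?thesis using nonneg[OF that, of i] by linarith
    qed
    show "0 \<le> q 0 i - p 0 i" for i using p init[of i] by (simp add: bd_flow_def)
  qed (rule t)
  then show ?thesis by simp
qed

lemma bd_flow_nonneg:
  assumes p: "bd_flow a b M f p" and f: "\<And>i. 0 \<le> f i" and t: "t \<ge> 0"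
  shows "0 \<le> p t i"
  using p f
  by (intro bd_nonneg[OF a_nonneg b_nonneg C_nonneg lyapunov _ _ _ t, where w = p and M = M])
     (auto simp: bd_flow_def abs_le_iff minus_le_iff)

section \<open>The heat kernel and its identification with the semigroup\<close>

definition heat_kernel :: "real \<Rightarrow> int \<Rightarrow> int \<Rightarrow> real" where
  "heat_kernel t i j = (SOME p. bd_flow a b 1 (\<lambda>i. if i = j then 1 else 0) p) t i"

lemma heat_kernel_flow: "bd_flow a b 1 (\<lambda>i. if i = j then 1 else 0) (\<lambda>t i. heat_kernel t i j)"
proof -
  have "\<exists>p. bd_flow a b 1 (\<lambda>i. if i = j then 1 else 0) p"
    by (rule bd_flow_exists) auto
  from someI_ex[OF this] show ?thesis unfolding heat_kernel_def by simp
qed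

lemma heat_kernel_nonneg: "t \<ge> 0 \<Longrightarrow> 0 \<le> heat_kernel t i j"
  by (rule bd_flow_nonneg[OF heat_kernel_flow]) auto

text \<open>One minus a finite partial sum is a solution bounded below with nonnegative initial
  data, so it stays nonnegative.\<close>

lemma heat_kernel_sum_le:
  assumes t: "t \<ge> 0" and A: "finite A"
  shows "(\<Sum>j\<in>A. heat_kernel t i j) \<le> 1"
proof -
  have flow: "0 \<le> heat_kernel t i j" "heat_kernel t i j \<le> 1"
    "((\<lambda>s. heat_kernel s i j) has_real_derivative bd_gen a b (\<lambda>i. heat_kernel t i j) i) (at t within {0..})"
    if "t \<ge> 0" for t i j
    using heat_kernel_flow[of j] heat_kernel_nonneg[OF that] that by (auto simp: bd_flow_def abs_le_iff)
  have "0 \<le> 1 - (\<Sum>j\<in>A. heat_kernel t i j)"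
  proof (rule bd_nonneg[OF a_nonneg b_nonneg C_nonneg lyapunov, where w = "\<lambda>t i. 1 - (\<Sum>j\<in>A. heat_kernel t i j)"])
    show "((\<lambda>s. 1 - (\<Sum>j\<in>A. heat_kernel s i j)) has_real_derivative
        bd_gen a b (\<lambda>i. 1 - (\<Sum>j\<in>A. heat_kernel t i j)) i) (at t within {0..})"
      if "t \<ge> 0" for t i
      unfolding bd_gen_diff bd_gen_sum bd_gen_const
      by (intro derivative_intros flow that)
    show "- real (card A) \<le> 1 - (\<Sum>j\<in>A. heat_kernel t i j)" if "t \<ge> 0" for t i
      using sum_bounded_above[of A "\<lambda>j. heat_kernel t i j" 1] flow[OF that] by simp
    show "0 \<le> 1 - (\<Sum>j\<in>A. heat_kernel 0 i j)" for i
    proof -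
      have "heat_kernel 0 i j = (if i = j then 1 else 0)" for j
        using heat_kernel_flow[of j] by (simp add: bd_flow_def fun_eq_iff)
      then show ?thesis using A by simp
    qed
  qed (rule t)
  then show ?thesis by simp
qed

text \<open>
  The Lyapunov function \<open>\<bar>i\<bar>\<close> makes the kernel tight: starting from data that vanishes on
  \<open>{-N..N}\<close>, the flow is \<open>O(1/N)\<close> locally uniformly.
\<close>

theorem bd_flow_has_sum:
  assumes V: "bd_flow a b M f V" and t: "t \<ge> 0"
  shows "((\<lambda>j. f j * heat_kernel t i j) has_sum V t i) UNIV"
proof -
  define S where "S N = {- int N..int N}" for N
  define R where "R = \<bar>real_of_int i\<bar> + (C + 1) * t"
  have fM: "\<bar>f j\<bar> \<le> M" for j
    using V unfolding bd_flow_def by (metis order_refl)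
  then have M: "M \<ge> 0" using abs_ge_zero[of "f 0"] order_trans by blast
  have close: "\<bar>V t i - (\<Sum>j\<in>S N. f j * heat_kernel t i j)\<bar> \<le> (2 * M + 1) * R / real N" if N: "N > 0" for N
  proof -
    define W where "W t i = V t i - (\<Sum>j\<in>S N. f j * heat_kernel t i j)" for t i
    have "\<bar>W t i\<bar> \<le> (2 * M + 1) / real_of_int (int N) * (\<bar>real_of_int i\<bar> + (C + 1) * t)"
    proof (rule bd_barrier_abs[where a = a and b = b])
      show "((\<lambda>s. W s i) has_real_derivative bd_gen a b (W t) i) (at t within {0..})" if "t \<ge> 0" for t i
      proof -
        have "((\<lambda>s. heat_kernel s i j) has_real_derivative bd_gen a b (\<lambda>i. heat_kernel t i j) i) (at t within {0..})" for j
          using heat_kernel_flow[of j] that by (simp add: bd_flow_def)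
        moreover have "((\<lambda>s. V s i) has_real_derivative bd_gen a b (V t) i) (at t within {0..})"
          using V that by (simp add: bd_flow_def)
        ultimately show ?thesis
          unfolding W_def[abs_def] bd_gen_diff bd_gen_sum bd_gen_cmult
          by (intro derivative_intros DERIV_cmult)
      qed
      show "\<bar>W t i\<bar> \<le> 2 * M + 1" if "t \<ge> 0" for t i
      proof -
        have "\<bar>\<Sum>j\<in>S N. f j * heat_kernel t i j\<bar> \<le> (\<Sum>j\<in>S N. M * heat_kernel t i j)"
          using heat_kernel_nonneg[OF that] fM
          by (intro order_trans[OF sum_abs] sum_mono) (simp add: abs_mult mult_right_mono)
        also have "\<dots> = M * (\<Sum>j\<in>S N. heat_kernel t i j)" by (simp add: sum_distrib_left)
        also have "\<dots> \<le> M * 1"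
          using M by (intro mult_left_mono heat_kernel_sum_le that) (simp_all add: S_def)
        moreover have "\<bar>V t i\<bar> \<le> M" using V that by (simp add: bd_flow_def)
        ultimately show ?thesis unfolding W_def by linarith
      qed
      show "\<bar>W 0 i\<bar> \<le> (2 * M + 1) / real_of_int (int N) * \<bar>real_of_int i\<bar>" if "\<bar>i\<bar> \<le> int N" for i
      proof -
        have hk: "heat_kernel 0 i j = (if i = j then 1 else 0)" for j
          using heat_kernel_flow[of j] by (simp add: bd_flow_def fun_eq_iff)
        have "(\<Sum>j\<in>S N. f j * heat_kernel 0 i j) = (\<Sum>j\<in>S N. if i = j then f j else 0)"
          by (intro sum.cong refl) (simp add: hk)
        also have "\<dots> = V 0 i" using that V by (auto simp: S_def bd_flow_def)
        finally show ?thesis using M by (simp add: W_def)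
      qed
    qed (use N M t in \<open>auto simp: a_nonneg b_nonneg C_nonneg lyapunov\<close>)
    then show ?thesis by (simp add: W_def R_def)
  qed
  have lim: "(\<lambda>N. \<Sum>j\<in>S N. f j * heat_kernel t i j) \<longlonglongrightarrow> V t i"
  proof (rule LIM_zero_cancel, rule Lim_null_comparison)
    show "\<forall>\<^sub>F N in sequentially. norm ((\<Sum>j\<in>S N. f j * heat_kernel t i j) - V t i) \<le> (2 * M + 1) * R / real N"
      using eventually_gt_at_top[of 0] by eventually_elim (use close in \<open>simp add: abs_minus_commute\<close>)
  qed (rule lim_const_over_n)
  \<comment> \<open>Convergence along symmetric boxes is not yet unconditional summability. The
    bound on kernel sums supplies the latter, and the box limit then identifies the value.\<close>
  have "(\<lambda>j. norm (f j * heat_kernel t i j)) summable_on UNIV"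
  proof (rule nonneg_bdd_above_summable_on)
    show "bdd_above (sum (\<lambda>j. norm (f j * heat_kernel t i j)) ` {F. F \<subseteq> UNIV \<and> finite F})"
    proof (rule bdd_aboveI2)
      fix A :: "int set" assume A: "A \<in> {F. F \<subseteq> UNIV \<and> finite F}"
      have "(\<Sum>j\<in>A. norm (f j * heat_kernel t i j)) \<le> (\<Sum>j\<in>A. M * heat_kernel t i j)"
        using heat_kernel_nonneg[OF t] fM by (intro sum_mono) (simp add: abs_mult mult_right_mono)
      also have "\<dots> = M * (\<Sum>j\<in>A. heat_kernel t i j)" by (simp add: sum_distrib_left)
      also have "\<dots> \<le> M * 1"
        using M A t by (intro mult_left_mono heat_kernel_sum_le) auto
      finally show "(\<Sum>j\<in>A. norm (f j * heat_kernel t i j)) \<le> M" by simp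
    qed
  qed auto
  then have "((\<lambda>j. f j * heat_kernel t i j) has_sum (\<Sum>\<^sub>\<infinity>j. f j * heat_kernel t i j)) UNIV"
    by (rule has_sum_infsum[OF abs_summable_summable])
  moreover from has_sum_int_symmetric[OF this] lim
  have "(\<Sum>\<^sub>\<infinity>j. f j * heat_kernel t i j) = V t i"
    unfolding S_def by (rule LIMSEQ_unique)
  ultimately show ?thesis by simp
qed

end

text \<open>The kernel lies below every nonnegative solution, hence is minimal. Two minimal
  solutions bound each other, so the chosen \<open>transition_prob\<close> is the kernel for
  \<open>t \<ge> 0\<close>.\<close>

theorem markov_semigroup_eq_bd_flow:
  assumes chain: "bd_chain (up_rate B u h) (down_rate B u h) C"
    and V: "bd_flow (up_rate B u h) (down_rate B u h) M f V" and t: "t \<ge> 0"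
  shows "markov_semigroup B u h t f i = V t i"
proof -
  interpret bd_chain "up_rate B u h" "down_rate B u h" C by (rule chain)
  have k0: "heat_kernel 0 i j = (if i = j then 1 else 0)" for i j
    using heat_kernel_flow[of j] by (simp add: bd_flow_def fun_eq_iff)
  have k_der: "((\<lambda>s. heat_kernel s i j) has_real_derivative generator B u h (\<lambda>k. heat_kernel t k j) i) (at t within {0..})"
    if "t \<ge> 0" for t i j
    using heat_kernel_flow[of j] that by (simp add: bd_flow_def generator_eq_bd_gen)
  have min: "minimal_backward_solution B u h heat_kernel"
    unfolding minimal_backward_solution_def
  proof (intro conjI allI impI)
    show "backward_solution B u h heat_kernel"
      unfolding backward_solution_def using k0 k_der heat_kernel_nonneg by blast
  next
    fix q :: "real \<Rightarrow> int \<Rightarrow> int \<Rightarrow> real" and t :: real and i j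
    assume q: "backward_solution B u h q" and t: "0 \<le> t"
    show "heat_kernel t i j \<le> q t i j"
      by (rule bd_flow_le[OF heat_kernel_flow])
         (use q t in \<open>auto simp: backward_solution_def generator_eq_bd_gen\<close>)
  qed
  then have tp: "minimal_backward_solution B u h (transition_prob B u h)"
    unfolding transition_prob_def by (rule someI[of _ heat_kernel])
  have "transition_prob B u h t i j = heat_kernel t i j" for j
    using min tp t unfolding minimal_backward_solution_def by (meson order_antisym)
  then have "markov_semigroup B u h t f i = (\<Sum>\<^sub>\<infinity>j. f j * heat_kernel t i j)"
    by (simp add: markov_semigroup_def)
  also have "\<dots> = V t i" by (rule infsumI[OF bd_flow_has_sum[OF V t]])
  finally show ?thesis .
qed

section \<open>Reflected chains on finite boxes\<close>

lemma nonincreasing_half_line: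
  fixes F :: "real \<Rightarrow> real"
  assumes der: "\<And>t. 0 \<le> t \<Longrightarrow> (F has_real_derivative F' t) (at t within {0..})"
    and neg: "\<And>t. 0 \<le> t \<Longrightarrow> F' t \<le> 0"
    and st: "0 \<le> s" "s \<le> t"
  shows "F t \<le> F s"
proof (rule DERIV_nonpos_imp_decreasing_open[OF st(2)])
  fix x assume x: "s < x" "x < t"
  then have "at x within {0..} = at x" using st by (intro at_within_interior) auto
  then show "\<exists>y. DERIV F x :> y \<and> y \<le> 0" using der[of x] neg[of x] x st by auto
next
  have "continuous_on {0..} F"
    using der by (intro DERIV_continuous_on) auto
  then show "continuous_on {s..t} F" by (rule continuous_on_subset) (use st in auto)
qed

lemma gronwall_half_line:
  fixes F :: "real \<Rightarrow> real"
  assumes der: "\<And>t. 0 \<le> t \<Longrightarrow> (F has_real_derivative F' t) (at t within {0..})"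
    and decay: "\<And>t. 0 \<le> t \<Longrightarrow> F' t \<le> - (c * F t)"
    and t: "0 \<le> t"
  shows "F t \<le> exp (- c * t) * F 0"
proof -
  have "exp (c * t) * F t \<le> exp (c * 0) * F 0"
  proof (rule nonincreasing_half_line[OF _ _ order_refl t])
    show "((\<lambda>t. exp (c * t) * F t) has_real_derivative exp (c * t) * (c * F t + F' t)) (at t within {0..})"
      if "0 \<le> t" for t
      by (rule derivative_eq_intros der that refl | simp add: algebra_simps)+
    show "exp (c * t) * (c * F t + F' t) \<le> 0" if "0 \<le> t" for t
      using decay[OF that] by (simp add: mult_nonneg_nonpos)
  qed
  then show ?thesis by (simp add: exp_minus field_simps)
qed

text \<open>Here \<open>J i\<close> is the flux across the edge from \<open>i\<close> to
  \<open>i + 1\<close>; the two vanishing values are the fluxes through the ends of the box.\<close>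

lemma sum_by_parts_int:
  fixes g J :: "int \<Rightarrow> real"
  assumes lo: "J (lo - 1) = 0" and hi: "J hi = 0" and le: "lo \<le> hi"
  shows "(\<Sum>i\<in>{lo..hi}. g i * (J i - J (i - 1))) = - (\<Sum>i\<in>{lo..<hi}. J i * (g (i + 1) - g i))"
proof -
  have "(\<Sum>i\<in>{lo..hi}. g i * J (i - 1)) = (\<Sum>i\<in>{lo-1..hi-1}. g (i + 1) * J i)"
    by (rule sum.reindex_bij_witness[of _ "\<lambda>i. i + 1" "\<lambda>i. i - 1"]) auto
  also have "\<dots> = (\<Sum>i\<in>{lo..<hi}. g (i + 1) * J i)"
    using lo by (intro sum.mono_neutral_right) (auto, metis diff_add_cancel eq_iff_diff_eq_0 int_one_le_iff_zero_less linorder_not_le order_antisym zle_diff1_eq)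
  finally have 1: "(\<Sum>i\<in>{lo..hi}. g i * J (i - 1)) = (\<Sum>i\<in>{lo..<hi}. g (i + 1) * J i)" .
  have "{lo..hi} = insert hi {lo..<hi}" using le by auto
  then have "(\<Sum>i\<in>{lo..hi}. g i * J i) = (\<Sum>i\<in>{lo..<hi}. g i * J i)"
    using hi by simp
  with 1 show ?thesis
    by (simp add: right_diff_distrib sum_subtractf mult.commute)
qed

section \<open>Variance and Dirichlet form on a box\<close>

locale bd_reversible = bd_chain +
  fixes m :: "int \<Rightarrow> real" and \<kappa> :: real
  assumes a_pos: "0 < a i" and m_pos: "0 < m i" and \<kappa>_pos: "0 < \<kappa>"
    and detailed_balance: "a i * m i = b (i + 1) * m (i + 1)"
    and curvature: "\<kappa> \<le> a i - a (i + 1) + b (i + 1) - b i"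
begin

definition trunc_mean :: "nat \<Rightarrow> (int \<Rightarrow> real) \<Rightarrow> real" where
  "trunc_mean n g = (\<Sum>i\<in>{- int n..int n}. m i * g i) / (\<Sum>i\<in>{- int n..int n}. m i)"

definition trunc_var :: "nat \<Rightarrow> (int \<Rightarrow> real) \<Rightarrow> real" where
  "trunc_var n g = (\<Sum>i\<in>{- int n..int n}. m i * (g i - trunc_mean n g)\<^sup>2)"

text \<open>The half-open range lists the edges of the box by left endpoint. Each is counted once
  with full weight, merging the two halves that its endpoints contribute to the carre du
  champ.\<close>

definition trunc_dirichlet :: "nat \<Rightarrow> (int \<Rightarrow> real) \<Rightarrow> real" where
  "trunc_dirichlet n g = (\<Sum>i\<in>{- int n..<int n}. a i * m i * (g (i + 1) - g i)\<^sup>2)"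

lemma trunc_mass_pos: "0 < (\<Sum>i\<in>{- int n..int n}. m i)"
  by (intro sum_pos m_pos) auto

text \<open>Detailed balance makes \<open>m\<close> times the generator the divergence of an edge
  flux, and reflection makes this flux vanish at both ends.\<close>

lemma trunc_green:
  "(\<Sum>i\<in>{- int n..int n}. m i * f i * bd_gen (trunc_up a n) (trunc_down b n) g i)
   = - (\<Sum>i\<in>{- int n..<int n}. a i * m i * (g (i + 1) - g i) * (f (i + 1) - f i))"
proof -
  define J where "J i = trunc_up a n i * m i * (g (i + 1) - g i)" for i
  have "m i * bd_gen (trunc_up a n) (trunc_down b n) g i = J i - J (i - 1)" for i
  proof -
    have "trunc_down b n i * m i = trunc_up a n (i - 1) * m (i - 1)"
      using detailed_balance[of "i - 1"] by (simp add: trunc_up_def trunc_down_def)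
    then show ?thesis by (simp add: J_def bd_gen_def algebra_simps)
  qed
  then have "(\<Sum>i\<in>{- int n..int n}. m i * f i * bd_gen (trunc_up a n) (trunc_down b n) g i)
    = (\<Sum>i\<in>{- int n..int n}. f i * (J i - J (i - 1)))"
    by (intro sum.cong refl) (simp add: mult.commute mult.left_commute)
  also have "\<dots> = - (\<Sum>i\<in>{- int n..<int n}. J i * (f (i + 1) - f i))"
    by (rule sum_by_parts_int) (auto simp: J_def trunc_up_def)
  also have "(\<Sum>i\<in>{- int n..<int n}. J i * (f (i + 1) - f i)) =
     (\<Sum>i\<in>{- int n..<int n}. a i * m i * (g (i + 1) - g i) * (f (i + 1) - f i))"
    by (intro sum.cong) (auto simp: J_def trunc_up_def)
  finally show ?thesis .
qed

text \<open>
  The discrete Bochner inequality: the increments satisfy a birth-death equation on the edges with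
  killing rate at least \<open>\<kappa>\<close>, and \<open>a i * m i\<close> is reversible for it.  Reflection at \<open>\<plusminus>n\<close> only
  increases the killing.
\<close>

lemma trunc_bochner:
  assumes n: "n > 0"
  defines "L \<equiv> bd_gen (trunc_up a n) (trunc_down b n)"
  shows "(\<Sum>i\<in>{- int n..<int n}. a i * m i * (2 * (g (i + 1) - g i) * (L g (i + 1) - L g i)))
    \<le> - (2 * \<kappa> * trunc_dirichlet n g)"
proof -
  define d where "d i = g (i + 1) - g i" for i
  define A where "A = trunc_up a n"
  define Bd where "Bd = trunc_down b n"
  \<comment> \<open>\<open>H\<close> is the flux of squared increments between adjacent edges; it is
    zero beyond the end edges, so its divergence sums to \<open>0\<close>.\<close>
  define H where "H i = (if - int n \<le> i \<and> i < int n - 1 then a i * m i * a (i + 1) * ((d (i + 1))\<^sup>2 - (d i)\<^sup>2) else 0)" for i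
  have A0: "0 \<le> A i" "0 \<le> Bd i" "A i \<le> a i" "Bd i \<le> b i" for i
    by (auto simp: A_def Bd_def trunc_up_def trunc_down_def a_nonneg b_nonneg)
  have pt: "a i * m i * (2 * (g (i + 1) - g i) * (L g (i + 1) - L g i))
       \<le> (H i - H (i - 1)) - 2 * \<kappa> * (a i * m i * (d i)\<^sup>2)"
    if i: "i \<in> {- int n..<int n}" for i
  proof -
    have Ai: "A i = a i" "Bd (i + 1) = b (i + 1)"
      using i by (auto simp: A_def Bd_def trunc_up_def trunc_down_def)
    have H1: "a i * m i * (A (i + 1) * ((d (i + 1))\<^sup>2 - (d i)\<^sup>2)) = H i"
      using i by (auto simp: H_def A_def trunc_up_def)
    have H2: "a i * m i * (Bd i * ((d i)\<^sup>2 - (d (i - 1))\<^sup>2)) = H (i - 1)"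
      using i detailed_balance[of "i - 1"] by (auto simp: H_def Bd_def trunc_down_def algebra_simps)
    define K where "K = A i - A (i + 1) + Bd (i + 1) - Bd i"
    have K: "\<kappa> \<le> K" unfolding K_def Ai using curvature[of i] A0[of i] A0[of "i + 1"] by linarith
    \<comment> \<open>Differencing the equation leaves a birth-death generator on edges, with up
      rate \<open>A (i + 1)\<close> and down rate \<open>Bd i\<close>, minus the killing
      term.\<close>
    have incr: "L g (i + 1) - L g i = A (i + 1) * (d (i + 1) - d i) - Bd i * (d i - d (i - 1)) - K * d i"
      by (simp add: L_def A_def Bd_def K_def bd_gen_def d_def algebra_simps)
    have "2 * d i * (L g (i + 1) - L g i)
      = A (i + 1) * (2 * d i * (d (i + 1) - d i)) + Bd i * (2 * d i * (d (i - 1) - d i)) - 2 * K * (d i)\<^sup>2"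
      unfolding incr by (simp add: algebra_simps power2_eq_square)
    also have "\<dots> \<le> A (i + 1) * ((d (i + 1))\<^sup>2 - (d i)\<^sup>2) + Bd i * ((d (i - 1))\<^sup>2 - (d i)\<^sup>2) - 2 * \<kappa> * (d i)\<^sup>2"
    proof -
      \<comment> \<open>The discarded square of \<open>x - y\<close> is the carre du champ of the
        edge chain, which has a favourable sign.\<close>
      have sq: "2 * x * (y - x) \<le> y\<^sup>2 - x\<^sup>2" for x y :: real
        using zero_le_power2[of "x - y"] by (simp add: algebra_simps power2_eq_square)
      show ?thesis
        by (intro diff_mono add_mono mult_left_mono sq A0 mult_right_mono) (use K in auto)
    qed
    finally have "a i * m i * (2 * d i * (L g (i + 1) - L g i)) \<le> a i * m i * (A (i + 1) * ((d (i + 1))\<^sup>2 - (d i)\<^sup>2) + Bd i * ((d (i - 1))\<^sup>2 - (d i)\<^sup>2) - 2 * \<kappa> * (d i)\<^sup>2)"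
      using a_pos[of i] m_pos[of i] by (intro mult_left_mono) auto
    also have "\<dots> = (H i - H (i - 1)) - 2 * \<kappa> * (a i * m i * (d i)\<^sup>2)"
      unfolding H1[symmetric] H2[symmetric] by (simp add: algebra_simps)
    finally show ?thesis by (simp add: d_def)
  qed
  \<comment> \<open>The factor \<open>1\<close> brings in summation by parts against a constant,
    whose increments vanish.\<close>
  have "(\<Sum>i\<in>{- int n..<int n}. H i - H (i - 1)) = (\<Sum>i\<in>{- int n..int n - 1}. 1 * (H i - H (i - 1)))"
    by (intro sum.cong) auto
  also have "\<dots> = 0"
    by (subst sum_by_parts_int) (use n in \<open>auto simp: H_def\<close>)
  finally have tele: "(\<Sum>i\<in>{- int n..<int n}. H i - H (i - 1)) = 0" .
  have "(\<Sum>i\<in>{- int n..<int n}. a i * m i * (2 * (g (i + 1) - g i) * (L g (i + 1) - L g i)))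
     \<le> (\<Sum>i\<in>{- int n..<int n}. (H i - H (i - 1)) - 2 * \<kappa> * (a i * m i * (d i)\<^sup>2))"
    by (intro sum_mono pt)
  also have "\<dots> = - (2 * \<kappa> * trunc_dirichlet n g)"
    unfolding sum_subtractf[of "\<lambda>i. H i - H (i - 1)"] tele
    by (simp add: trunc_dirichlet_def d_def sum_distrib_left)
  finally show ?thesis .
qed

theorem trunc_energy_decay:
  assumes U: "bd_flow (trunc_up a n) (trunc_down b n) M f U" and n: "n > 0" and t: "0 \<le> t"
  shows "trunc_var n (U t) + trunc_dirichlet n (U t)
     \<le> exp (- (2 * \<kappa>) * t) * (trunc_var n f + trunc_dirichlet n f)"
proof -
  define L where "L = bd_gen (trunc_up a n) (trunc_down b n)"
  define S where "S = {- int n..int n}"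
  define Z where "Z = (\<Sum>i\<in>S. m i)"
  define V where "V t = trunc_var n (U t)" for t
  define E where "E t = trunc_dirichlet n (U t)" for t
  define c where "c t = trunc_mean n (U t)" for t
  define E' where "E' t = (\<Sum>i\<in>{- int n..<int n}. a i * m i * (2 * (U t (i + 1) - U t i) * (L (U t) (i + 1) - L (U t) i)))" for t
  have Z: "Z > 0" unfolding Z_def S_def by (rule trunc_mass_pos)
  have U_der: "((\<lambda>s. U s i) has_real_derivative L (U t) i) (at t within {0..})" if "t \<ge> 0" for t i
    using U that by (simp add: bd_flow_def L_def)
  have c_der: "(c has_real_derivative 0) (at t within {0..})" if "t \<ge> 0" for t
  proof -
    have "(c has_real_derivative (\<Sum>i\<in>S. m i * L (U t) i) / Z) (at t within {0..})"
      unfolding c_def[abs_def] trunc_mean_def S_def[symmetric] Z_def[symmetric]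
      by (intro DERIV_cdivide DERIV_sum DERIV_cmult U_der that)
    also have "(\<Sum>i\<in>S. m i * L (U t) i) = 0"
      using trunc_green[where n = n and f = "\<lambda>_. 1" and g = "U t"] by (simp add: S_def L_def)
    finally show ?thesis by simp
  qed
  have V_der: "(V has_real_derivative - (2 * E t)) (at t within {0..})" if "t \<ge> 0" for t
  proof -
    have "(V has_real_derivative (\<Sum>i\<in>S. m i * (2 * (U t i - c t) * (L (U t) i - 0)))) (at t within {0..})"
      unfolding V_def[abs_def] trunc_var_def S_def[symmetric] c_def[symmetric]
      by (rule derivative_eq_intros U_der c_der that refl | simp add: algebra_simps)+
    also have "(\<Sum>i\<in>S. m i * (2 * (U t i - c t) * (L (U t) i - 0)))
        = 2 * (\<Sum>i\<in>S. m i * (U t i - c t) * L (U t) i)"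
      unfolding sum_distrib_left by (intro sum.cong refl) simp
    also have "(\<Sum>i\<in>S. m i * (U t i - c t) * L (U t) i) = - E t"
      using trunc_green[where n = n and f = "\<lambda>i. U t i - c t" and g = "U t"]
      by (simp add: S_def L_def E_def trunc_dirichlet_def power2_eq_square mult.assoc)
    finally show ?thesis by simp
  qed
  have E_der: "(E has_real_derivative E' t) (at t within {0..})" if "t \<ge> 0" for t
    unfolding E_def[abs_def] E'_def trunc_dirichlet_def
    by (rule derivative_eq_intros U_der that refl | simp add: algebra_simps)+
  have E'_le: "E' t \<le> - (2 * \<kappa> * E t)" for t
    unfolding E'_def E_def L_def by (rule trunc_bochner[OF n])
  have E_nonneg: "0 \<le> E t" for t
    unfolding E_def trunc_dirichlet_def using a_pos m_pos by (intro sum_nonneg) (simp add: less_imp_le)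
  have E_lim: "(E \<longlongrightarrow> 0) at_top"
  proof (rule tendsto_sandwich[of "\<lambda>_. 0" _ _ "\<lambda>t. exp (- (2 * \<kappa>) * t) * E 0"])
    show "\<forall>\<^sub>F t in at_top. E t \<le> exp (- (2 * \<kappa>) * t) * E 0"
      using eventually_ge_at_top[of 0]
      by eventually_elim (rule gronwall_half_line[OF E_der], use E'_le in auto)
    have "((\<lambda>t. exp (- (2 * \<kappa>) * t)) \<longlongrightarrow> 0) at_top"
      using \<kappa>_pos by (intro filterlim_compose[OF exp_at_bot] filterlim_tendsto_neg_mult_at_bot[OF tendsto_const] filterlim_ident) auto
    then show "((\<lambda>t. exp (- (2 * \<kappa>) * t) * E 0) \<longlongrightarrow> 0) at_top"
      by (rule tendsto_mult_left_zero)
  qed (auto simp: E_nonneg)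
  \<comment> \<open>Positive edge weights turn decay of \<open>E\<close> into decay of every
    increment. Chaining increments across the box flattens the flow to its mean, so the variance
    tends to \<open>0\<close>.\<close>
  have D_lim: "((\<lambda>t. U t (i + 1) - U t i) \<longlongrightarrow> 0) at_top" if i: "i \<in> {- int n..<int n}" for i
  proof -
    have w: "a i * m i > 0" using a_pos m_pos by simp
    have "((\<lambda>t. (U t (i + 1) - U t i)\<^sup>2) \<longlongrightarrow> 0) at_top"
    proof (rule tendsto_sandwich[of "\<lambda>_. 0" _ _ "\<lambda>t. E t / (a i * m i)"])
      have "a i * m i * (U t (i + 1) - U t i)\<^sup>2 \<le> E t" for t
        unfolding E_def trunc_dirichlet_def
        using a_pos m_pos by (intro member_le_sum[OF i]) (auto simp: less_imp_le)
      then show "\<forall>\<^sub>F t in at_top. (U t (i + 1) - U t i)\<^sup>2 \<le> E t / (a i * m i)"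
        using w by (intro always_eventually allI) (simp add: pos_le_divide_eq mult.commute)
      show "((\<lambda>t. E t / (a i * m i)) \<longlongrightarrow> 0) at_top"
        by (rule tendsto_divide_zero[OF E_lim])
    qed auto
    from tendsto_real_sqrt[OF this] show ?thesis by (simp add: tendsto_rabs_zero_iff)
  qed
  have end_lim: "((\<lambda>t. U t i - U t (- int n)) \<longlongrightarrow> 0) at_top" if "- int n \<le> i" "i \<le> int n" for i
    using that
  proof (induction i rule: int_ge_induct)
    case (step i)
    then have "((\<lambda>t. (U t (i + 1) - U t i) + (U t i - U t (- int n))) \<longlongrightarrow> 0 + 0) at_top"
      by (intro tendsto_add D_lim) auto
    then show ?case by simp
  qed simp
  have c_lim: "((\<lambda>t. U t i - c t) \<longlongrightarrow> 0) at_top" if i: "i \<in> S" for i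
  proof -
    have "U t i - c t = (\<Sum>j\<in>S. m j * ((U t i - U t (- int n)) - (U t j - U t (- int n)))) / Z" for t
    proof -
      have "(\<Sum>j\<in>S. m j * ((U t i - U t (- int n)) - (U t j - U t (- int n)))) = Z * U t i - (\<Sum>j\<in>S. m j * U t j)"
        by (simp add: Z_def right_diff_distrib sum_subtractf sum_distrib_right)
      then show ?thesis
        using Z by (simp add: c_def trunc_mean_def S_def[symmetric] Z_def[symmetric] diff_divide_distrib)
    qed
    moreover have "((\<lambda>t. (\<Sum>j\<in>S. m j * ((U t i - U t (- int n)) - (U t j - U t (- int n)))) / Z) \<longlongrightarrow> (\<Sum>j\<in>S. m j * (0 - 0)) / Z) at_top"
      using i Z by (intro tendsto_intros end_lim) (auto simp: S_def)
    ultimately show ?thesis by simp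
  qed
  have V_lim: "(V \<longlongrightarrow> 0) at_top"
  proof -
    have "(V \<longlongrightarrow> (\<Sum>i\<in>S. m i * 0\<^sup>2)) at_top"
      unfolding V_def[abs_def] trunc_var_def S_def[symmetric] c_def[symmetric]
      by (intro tendsto_intros c_lim)
    then show ?thesis by simp
  qed
  have poincare: "\<kappa> * V s \<le> E s" if s: "0 \<le> s" for s
  proof -
    have "((\<lambda>t. E t - \<kappa> * V t) \<longlongrightarrow> 0 - \<kappa> * 0) at_top"
      by (intro tendsto_intros E_lim V_lim)
    moreover have "\<forall>\<^sub>F t in at_top. E t - \<kappa> * V t \<le> E s - \<kappa> * V s"
      using eventually_ge_at_top[of s]
    proof eventually_elim
      case (elim t)
      show ?case
      proof (rule nonincreasing_half_line[OF _ _ s elim])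
        show "((\<lambda>t. E t - \<kappa> * V t) has_real_derivative E' t - \<kappa> * (- (2 * E t))) (at t within {0..})"
          if "0 \<le> t" for t
          by (intro derivative_intros DERIV_cmult E_der V_der that)
        show "E' t - \<kappa> * (- (2 * E t)) \<le> 0" for t using E'_le[of t] by simp
      qed
    qed
    ultimately show ?thesis
      using tendsto_upperbound[of _ _ at_top] by force
  qed
  have "V t + E t \<le> exp (- (2 * \<kappa>) * t) * (V 0 + E 0)"
  proof (rule gronwall_half_line[OF _ _ t])
    show "((\<lambda>t. V t + E t) has_real_derivative - (2 * E t) + E' t) (at t within {0..})" if "0 \<le> t" for t
      by (intro DERIV_add E_der V_der that)
    \<comment> \<open>The bound on \<open>E'\<close> gives the \<open>E\<close> part, and the
      Poincare inequality converts \<open>- (2 * E t)\<close> into the \<open>V\<close>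
      part.\<close>
    show "- (2 * E t) + E' t \<le> - (2 * \<kappa> * (V t + E t))" if "0 \<le> t" for t
      using E'_le[of t] poincare[OF that] by (simp add: algebra_simps)
  qed
  moreover have "U 0 = f" using U by (simp add: bd_flow_def)
  ultimately show ?thesis by (simp add: V_def E_def)
qed

end

section \<open>Passage to the infinite chain\<close>

text \<open>For absolutely summable families the unordered sum is the integral against counting
  measure, so Lebesgue's theorem transfers.\<close>

lemma infsum_dominated_convergence:
  fixes F :: "nat \<Rightarrow> 'a::countable \<Rightarrow> real"
  assumes w: "w summable_on UNIV" and bound: "\<And>n i. \<bar>F n i\<bar> \<le> w i"
    and lim: "\<And>i. (\<lambda>n. F n i) \<longlonglongrightarrow> G i"
  shows "G summable_on UNIV" and "(\<lambda>n. \<Sum>\<^sub>\<infinity>i. F n i) \<longlonglongrightarrow> (\<Sum>\<^sub>\<infinity>i. G i)"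
proof -
  have int_eq: "integrable (count_space UNIV) f \<Longrightarrow> f summable_on UNIV \<and> integral\<^sup>L (count_space UNIV) f = (\<Sum>\<^sub>\<infinity>i. f i)"
    for f :: "'a \<Rightarrow> real"
    using infsetsum_infsum[of f UNIV] abs_summable_equivalent[of f UNIV] abs_summable_summable[of f UNIV]
    unfolding infsetsum_def Infinite_Set_Sum.abs_summable_on_def by simp
  have w': "integrable (count_space UNIV) w"
    using w abs_summable_equivalent[of w UNIV] summable_on_iff_abs_summable_on_real[of w UNIV]
    unfolding Infinite_Set_Sum.abs_summable_on_def by simp
  have int_F: "integrable (count_space UNIV) (F n)" for n
    by (rule Bochner_Integration.integrable_bound[OF w'])
       (use bound order_trans[OF bound abs_ge_self] in auto)
  have bound_G: "\<bar>G i\<bar> \<le> w i" for i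
    using tendsto_upperbound[OF tendsto_rabs[OF lim[of i]]] bound by auto
  have int_G: "integrable (count_space UNIV) G"
    by (rule Bochner_Integration.integrable_bound[OF w'])
       (use bound_G order_trans[OF bound_G abs_ge_self] in auto)
  have lim_int: "(\<lambda>n. integral\<^sup>L (count_space UNIV) (F n)) \<longlonglongrightarrow> integral\<^sup>L (count_space UNIV) G"
    by (rule integral_dominated_convergence[where w = w]) (use w' bound lim in auto)
  show "G summable_on UNIV" using int_eq[OF int_G] by simp
  show "(\<lambda>n. \<Sum>\<^sub>\<infinity>i. F n i) \<longlonglongrightarrow> (\<Sum>\<^sub>\<infinity>i. G i)"
    using lim_int int_eq[OF int_G] int_eq[OF int_F] by simp
qed

text \<open>Extension by zero outside \<open>A n\<close> keeps the majorant, and the pointwise limit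
  persists because each index eventually lies in \<open>A n\<close>.\<close>

lemma finite_sums_dominated_convergence:
  fixes F :: "nat \<Rightarrow> 'a::countable \<Rightarrow> real"
  assumes w: "w summable_on UNIV" and bound: "\<And>n i. \<bar>F n i\<bar> \<le> w i"
    and lim: "\<And>i. (\<lambda>n. F n i) \<longlonglongrightarrow> G i"
    and A: "\<And>n. finite (A n)" "\<And>i. \<forall>\<^sub>F n in sequentially. i \<in> A n"
  shows "(\<lambda>n. \<Sum>i\<in>A n. F n i) \<longlonglongrightarrow> (\<Sum>\<^sub>\<infinity>i. G i)"
proof -
  define H where "H n i = (if i \<in> A n then F n i else 0)" for n i
  have "(\<lambda>n. H n i) \<longlonglongrightarrow> G i" for i
    using lim[of i] by (rule Lim_transform_eventually)
      (use A(2)[of i] in \<open>eventually_elim, simp add: H_def\<close>)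
  moreover have "\<bar>H n i\<bar> \<le> w i" for n i
    using bound[of n i] order_trans[OF abs_ge_zero bound[of n i]] by (simp add: H_def)
  ultimately have "(\<lambda>n. \<Sum>\<^sub>\<infinity>i. H n i) \<longlonglongrightarrow> (\<Sum>\<^sub>\<infinity>i. G i)"
    by (intro infsum_dominated_convergence[OF w])
  moreover have "(\<Sum>\<^sub>\<infinity>i. H n i) = (\<Sum>i\<in>A n. F n i)" for n
  proof -
    have "(\<Sum>\<^sub>\<infinity>i. H n i) = (\<Sum>\<^sub>\<infinity>i\<in>A n. F n i)"
      by (rule infsum_cong_neutral) (auto simp: H_def)
    then show ?thesis using A by simp
  qed
  ultimately show ?thesis by simp
qed

lemma eventually_in_int_box:
  "\<forall>\<^sub>F n in sequentially. (i::int) \<in> {- int n..int n}"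
  "\<forall>\<^sub>F n in sequentially. (i::int) \<in> {- int n..<int n}"
  by (rule eventually_mono[OF eventually_gt_at_top[of "nat \<bar>i\<bar>"]], auto)+

section \<open>Mean, variance and Dirichlet form on all integers\<close>

locale bd_reversible_finite = bd_reversible +
  assumes m_summable: "m summable_on UNIV"
    and am_summable: "(\<lambda>i. a i * m i) summable_on UNIV"
begin

definition mass :: real where
  "mass = (\<Sum>\<^sub>\<infinity>i. m i)"

definition mean :: "(int \<Rightarrow> real) \<Rightarrow> real" where
  "mean g = (\<Sum>\<^sub>\<infinity>i. m i * g i) / mass"

definition variance :: "(int \<Rightarrow> real) \<Rightarrow> real" where
  "variance g = (\<Sum>\<^sub>\<infinity>i. m i * (g i - mean g)\<^sup>2)"

definition dirichlet :: "(int \<Rightarrow> real) \<Rightarrow> real" where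
  "dirichlet g = (\<Sum>\<^sub>\<infinity>i. a i * m i * (g (i + 1) - g i)\<^sup>2)"

lemma mass_pos: "0 < mass"
proof -
  have "m 0 = (\<Sum>\<^sub>\<infinity>i\<in>{0}. m i)" by simp
  also have "\<dots> \<le> mass"
    unfolding mass_def using m_summable m_pos
    by (intro infsum_mono2) (auto simp: less_imp_le)
  finally show ?thesis using m_pos[of 0] by simp
qed

lemma m_mult_summable:
  assumes "\<And>i. \<bar>g i\<bar> \<le> M"
  shows "(\<lambda>i. m i * g i) summable_on UNIV"
  using infsum_dominated_convergence(1)[of "\<lambda>i. m i * M" "\<lambda>n i. m i * g i" "\<lambda>i. m i * g i"]
    summable_on_cmult_left[OF m_summable, of M] assms m_pos
  by (simp add: abs_mult less_imp_le mult_left_mono)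

lemma am_mult_summable:
  assumes "\<And>i. \<bar>g i\<bar> \<le> M"
  shows "(\<lambda>i. a i * m i * g i) summable_on UNIV"
  using infsum_dominated_convergence(1)[of "\<lambda>i. a i * m i * M" "\<lambda>n i. a i * m i * g i" "\<lambda>i. a i * m i * g i"]
    summable_on_cmult_left[OF am_summable, of M] assms m_pos a_pos
  by (simp add: abs_mult less_imp_le mult_left_mono)

context
  fixes g :: "nat \<Rightarrow> int \<Rightarrow> real" and G :: "int \<Rightarrow> real" and M :: real
  assumes g_lim: "\<And>i. (\<lambda>n. g n i) \<longlonglongrightarrow> G i" and g_bound: "\<And>n i. \<bar>g n i\<bar> \<le> M"
begin

text \<open>Box and function vary together with \<open>n\<close>, since each reflected flow belongs
  to its own box.\<close>

lemma trunc_mean_tendsto: "(\<lambda>n. trunc_mean n (g n)) \<longlonglongrightarrow> mean G"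
proof -
  have "(\<lambda>n. \<Sum>i\<in>{- int n..int n}. m i * g n i) \<longlonglongrightarrow> (\<Sum>\<^sub>\<infinity>i. m i * G i)"
    using m_pos g_bound
    by (intro finite_sums_dominated_convergence[where w = "\<lambda>i. m i * M"] tendsto_intros g_lim
        summable_on_cmult_left m_summable eventually_in_int_box)
       (auto simp: abs_mult less_imp_le mult_left_mono)
  moreover have "(\<lambda>n. \<Sum>i\<in>{- int n..int n}. m i) \<longlonglongrightarrow> mass"
    unfolding mass_def using m_pos
    by (intro finite_sums_dominated_convergence[where w = m] tendsto_const m_summable eventually_in_int_box)
       (auto simp: less_imp_le)
  ultimately show ?thesis
    unfolding trunc_mean_def mean_def using mass_pos by (intro tendsto_divide) auto
qed

lemma trunc_mean_bound: "\<bar>trunc_mean n (g n)\<bar> \<le> M"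
proof -
  have "\<bar>\<Sum>i\<in>{- int n..int n}. m i * g n i\<bar> \<le> (\<Sum>i\<in>{- int n..int n}. m i * M)"
    using m_pos g_bound
    by (intro order_trans[OF sum_abs] sum_mono) (auto simp: abs_mult less_imp_le mult_left_mono)
  then show ?thesis
    using trunc_mass_pos[of n]
    by (simp add: trunc_mean_def abs_divide pos_divide_le_eq sum_distrib_left[symmetric] sum_distrib_right mult.commute)
qed

lemma trunc_var_tendsto: "(\<lambda>n. trunc_var n (g n)) \<longlonglongrightarrow> variance G"
  unfolding trunc_var_def variance_def
proof (rule finite_sums_dominated_convergence[where w = "\<lambda>i. m i * (2 * M)\<^sup>2"])
  show "\<bar>m i * (g n i - trunc_mean n (g n))\<^sup>2\<bar> \<le> m i * (2 * M)\<^sup>2" for n i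
  proof -
    have "\<bar>g n i - trunc_mean n (g n)\<bar> \<le> 2 * M"
      using g_bound[of n i] trunc_mean_bound[of n] by linarith
    then have "(g n i - trunc_mean n (g n))\<^sup>2 \<le> (2 * M)\<^sup>2"
      by (rule power2_le_iff_abs_le[THEN iffD2, rotated]) (use g_bound[of n i] in linarith)
    then show ?thesis using m_pos[of i] by (simp add: abs_mult)
  qed
qed (auto intro!: tendsto_intros g_lim trunc_mean_tendsto summable_on_cmult_left m_summable
       intro: eventually_in_int_box simp del: atLeastAtMost_iff)

lemma trunc_dirichlet_tendsto: "(\<lambda>n. trunc_dirichlet n (g n)) \<longlonglongrightarrow> dirichlet G"
  unfolding trunc_dirichlet_def dirichlet_def
proof (rule finite_sums_dominated_convergence[where w = "\<lambda>i. a i * m i * (2 * M)\<^sup>2"])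
  show "\<bar>a i * m i * (g n (i + 1) - g n i)\<^sup>2\<bar> \<le> a i * m i * (2 * M)\<^sup>2" for n i
  proof -
    have "\<bar>g n (i + 1) - g n i\<bar> \<le> 2 * M"
      using g_bound[of n i] g_bound[of n "i + 1"] by linarith
    then have "(g n (i + 1) - g n i)\<^sup>2 \<le> (2 * M)\<^sup>2"
      by (rule power2_le_iff_abs_le[THEN iffD2, rotated]) (use g_bound[of n i] in linarith)
    then show ?thesis using m_pos[of i] a_pos[of i] by (simp add: abs_mult)
  qed
qed (auto intro!: tendsto_intros g_lim summable_on_cmult_left am_summable
       intro: eventually_in_int_box simp del: atLeastLessThan_iff)

end

text \<open>At fixed time the estimate on boxes passes to the limit: the common bound
  \<open>M\<close> supplies the majorants on both sides.\<close>

theorem energy_decay: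
  assumes f: "\<And>i. \<bar>f i\<bar> \<le> M"
  obtains V where "bd_flow a b M f V"
    "\<And>t. 0 \<le> t \<Longrightarrow> variance (V t) + dirichlet (V t) \<le> exp (- (2 * \<kappa>) * t) * (variance f + dirichlet f)"
proof -
  have "\<forall>n. \<exists>U. bd_flow (trunc_up a n) (trunc_down b n) M f U"
    using bd_flow_trunc_exists[of a b f M] a_nonneg b_nonneg f by simp
  then obtain U where U: "\<And>n. bd_flow (trunc_up a n) (trunc_down b n) M f (U n)" by metis
  obtain V where V: "bd_flow a b M f V" "\<And>t i. 0 \<le> t \<Longrightarrow> (\<lambda>n. U n t i) \<longlonglongrightarrow> V t i"
    using trunc_flow_converges[OF U] by blast
  have "variance (V t) + dirichlet (V t) \<le> exp (- (2 * \<kappa>) * t) * (variance f + dirichlet f)"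
    if t: "0 \<le> t" for t
  proof (rule LIMSEQ_le)
    have "\<bar>U n t i\<bar> \<le> M" for n i using U[of n] t by (simp add: bd_flow_def)
    then show "(\<lambda>n. trunc_var n (U n t) + trunc_dirichlet n (U n t)) \<longlonglongrightarrow> variance (V t) + dirichlet (V t)"
      by (intro tendsto_add trunc_var_tendsto[where M = M] trunc_dirichlet_tendsto[where M = M] V t)
    show "(\<lambda>n. exp (- (2 * \<kappa>) * t) * (trunc_var n f + trunc_dirichlet n f))
        \<longlonglongrightarrow> exp (- (2 * \<kappa>) * t) * (variance f + dirichlet f)"
      by (intro tendsto_mult tendsto_const tendsto_add trunc_var_tendsto[where M = M]
          trunc_dirichlet_tendsto[where M = M] f)
    show "\<exists>N. \<forall>n\<ge>N. trunc_var n (U n t) + trunc_dirichlet n (U n t)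
        \<le> exp (- (2 * \<kappa>) * t) * (trunc_var n f + trunc_dirichlet n f)"
      using trunc_energy_decay[OF U _ t] by (intro exI[of _ 1]) auto
  qed
  with V show thesis by (intro that)
qed

end

text \<open>By detailed balance the downward half of the carre du champ at \<open>i\<close> is the
  upward half at \<open>i - 1\<close>; a shift of the sum merges the halves into the Dirichlet
  form.\<close>

lemma (in bd_reversible_finite) energy_eq:
  assumes rates: "a = up_rate B u h" "b = down_rate B u h" and m: "m = (\<lambda>i. exp (- grid u h i))"
    and g: "\<And>i. \<bar>g i\<bar> \<le> M"
  shows "energy B u h g = (variance g + dirichlet g) / mass"
proof -
  have gibbs: "gibbs u h i = m i / mass" for i
    unfolding gibbs_def mass_def by (simp add: m)
  have mean: "pairing g (gibbs u h) = mean g"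
  proof -
    have "pairing g (gibbs u h) = (\<Sum>\<^sub>\<infinity>i. inverse mass * (m i * g i))"
      unfolding pairing_def gibbs by (intro infsum_cong) (simp add: field_simps)
    then show ?thesis
      by (simp only: infsum_cmult_right' mean_def divide_inverse_commute)
  qed
  define q where "q i = a i * m i * (g (i + 1) - g i)\<^sup>2" for i
  define v where "v i = m i * (g i - mean g)\<^sup>2" for i
  have sq_bound: "\<bar>x\<^sup>2\<bar> \<le> (M + c)\<^sup>2" if "\<bar>x\<bar> \<le> M + c" for x c
    using power_mono[OF that, of 2] by simp
  have q: "q summable_on UNIV"
    unfolding q_def
  proof (rule am_mult_summable, rule sq_bound)
    show "\<bar>g (i + 1) - g i\<bar> \<le> M + M" for i using g[of i] g[of "i + 1"] by linarith
  qed
  have v: "v summable_on UNIV"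
    unfolding v_def
  proof (rule m_mult_summable, rule sq_bound)
    show "\<bar>g i - mean g\<bar> \<le> M + \<bar>mean g\<bar>" for i using g[of i] by linarith
  qed
  have shift: "bij_betw (\<lambda>i::int. i - 1) UNIV UNIV"
    by (rule bij_betwI[where g = "\<lambda>i. i + 1"]) auto
  have q': "(\<lambda>i. q (i - 1)) summable_on UNIV" "(\<Sum>\<^sub>\<infinity>i. q (i - 1)) = dirichlet g"
    using summable_on_reindex_bij_betw[OF shift, of q] infsum_reindex_bij_betw[OF shift, of q] q
    by (simp_all add: dirichlet_def q_def[abs_def])
  have "energy B u h g = (\<Sum>\<^sub>\<infinity>i. inverse mass * (v i + (1 / 2 * q i + 1 / 2 * q (i - 1))))"
    unfolding energy_def mean
  proof (unfold pairing_def, rule infsum_cong)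
    fix i :: int
    have "m i * carre_du_champ B u h g g i = 1 / 2 * q i + 1 / 2 * (b i * m i * (g i - g (i - 1))\<^sup>2)"
      unfolding carre_du_champ_def rates[symmetric] q_def fwd_diff_def bwd_diff_def
      by (simp only: power2_eq_square distrib_left mult_ac)
    also have "b i * m i * (g i - g (i - 1))\<^sup>2 = q (i - 1)"
      using detailed_balance[of "i - 1"] by (simp add: q_def)
    finally have carre: "m i * carre_du_champ B u h g g i = 1 / 2 * q i + 1 / 2 * q (i - 1)" .
    show "((g i - mean g)\<^sup>2 + carre_du_champ B u h g g i) * gibbs u h i
        = inverse mass * (v i + (1 / 2 * q i + 1 / 2 * q (i - 1)))"
      unfolding carre[symmetric] gibbs v_def by (simp only: divide_inverse distrib_left distrib_right mult_ac)
  qed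
  also have "\<dots> = inverse mass * ((\<Sum>\<^sub>\<infinity>i. v i) + (1 / 2 * (\<Sum>\<^sub>\<infinity>i. q i) + 1 / 2 * (\<Sum>\<^sub>\<infinity>i. q (i - 1))))"
    by (intro infsumI has_sum_cmult_right has_sum_add has_sum_infsum v q q'(1))
  also have "\<dots> = (variance g + dirichlet g) / mass"
    unfolding q' by (simp add: variance_def v_def[abs_def] dirichlet_def q_def[abs_def] field_simps)
  finally show ?thesis .
qed

section \<open>Rates built from a convex weight and a convex potential\<close>

text \<open>The points \<open>x + d\<close> and \<open>y\<close> are convex combinations of
  \<open>x\<close> and \<open>y + d\<close> with complementary weights; the two convexity
  inequalities are added.\<close>

lemma convex_increments_mono:
  fixes f :: "real \<Rightarrow> real"
  assumes f: "convex_on UNIV f" and xy: "x \<le> y" and d: "0 \<le> d"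
  shows "f (x + d) - f x \<le> f (y + d) - f y"
proof (cases "x < y \<and> 0 < d")
  case True
  define r where "r = d / (y + d - x)"
  have r: "0 \<le> r" "r \<le> 1" using True by (auto simp: r_def)
  have "r * (y + d - x) = d" using True by (simp add: r_def)
  then have "x + d = (1 - r) *\<^sub>R x + r *\<^sub>R (y + d)" "y = (1 - (1 - r)) *\<^sub>R x + (1 - r) *\<^sub>R (y + d)"
    by (simp_all add: algebra_simps)
  then have "f (x + d) \<le> (1 - r) * f x + r * f (y + d)" "f y \<le> (1 - (1 - r)) * f x + (1 - r) * f (y + d)"
    using convex_onD[OF f, of r x "y + d"] convex_onD[OF f, of "1 - r" x "y + d"] r by simp_all
  then show ?thesis by (simp add: algebra_simps)
qed (use xy d in auto)

lemma summable_on_int_geometric: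
  fixes q :: real
  assumes "0 \<le> q" "q < 1"
  shows "(\<lambda>i::int. q ^ nat \<bar>i\<bar>) summable_on UNIV"
proof -
  have geo: "(\<lambda>n::nat. q ^ n) summable_on UNIV"
    using assms by (simp add: summable_on_UNIV_nonneg_real_iff summable_geometric)
  have "(\<lambda>i::int. q ^ nat \<bar>i\<bar>) summable_on range int"
    by (subst summable_on_reindex) (use geo in \<open>auto simp: o_def\<close>)
  moreover have "(\<lambda>i::int. q ^ nat \<bar>i\<bar>) summable_on range (\<lambda>n. - int n - 1)"
  proof (subst summable_on_reindex)
    have "(\<lambda>n::nat. q * q ^ n) summable_on UNIV" by (rule summable_on_cmult_right[OF geo])
    moreover have "q ^ nat \<bar>- int n - 1\<bar> = q * q ^ n" for n
      by (simp add: nat_add_distrib flip: power_Suc)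
    ultimately show "(\<lambda>i::int. q ^ nat \<bar>i\<bar>) \<circ> (\<lambda>n. - int n - 1) summable_on UNIV"
      by (simp add: o_def)
  qed (auto simp: inj_def)
  moreover have "range int \<inter> range (\<lambda>n. - int n - 1) = {}" by auto
  moreover have "(UNIV :: int set) = range int \<union> range (\<lambda>n. - int n - 1)"
  proof -
    have "i \<in> range int \<union> range (\<lambda>n. - int n - 1)" for i :: int
      by (cases "i \<ge> 0") (auto intro: range_eqI[of _ _ "nat i"] range_eqI[of _ _ "nat (- i - 1)"])
    then show ?thesis by auto
  qed
  ultimately show ?thesis by (metis summable_on_Un_disjoint)
qed

section \<open>Drops of a convex admissible weight\<close>

locale convex_weight =
  fixes B :: "real \<Rightarrow> real"
  assumes adm: "admissible B" and conv: "convex_on UNIV B"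
begin

lemma B_pos: "0 < B s" and B_0: "B 0 = 1" and B_antimono: "s \<le> t \<Longrightarrow> B t \<le> B s"
  using adm unfolding admissible_def antimono_def by auto

lemma B_minus: "B (- s) = exp s * B s"
proof -
  have "ln (B (- s)) = s + ln (B s)"
    using adm unfolding admissible_def by (metis diff_add_cancel)
  then have "exp (ln (B (- s))) = exp s * exp (ln (B s))" by (simp add: exp_add)
  then show ?thesis by (simp add: B_pos)
qed

text \<open>
  Differentiating \<open>B (- s) = exp s * B s\<close> at \<open>0\<close> gives \<open>B' 0 = - 1 / 2\<close>.
\<close>

lemma B_less_1:
  assumes x: "0 < x"
  shows "B x < 1"
proof -
  obtain d where d: "(B has_real_derivative d) (at 0)"
    using adm unfolding admissible_def C1_differentiable_on_def
    by (auto simp: has_real_derivative_iff_has_vector_derivative)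
  have d0: "(B has_real_derivative d) (at (- 0))" using d by simp
  have "((\<lambda>s. B (- s)) has_real_derivative d * (- 1)) (at 0)"
    by (rule DERIV_chain'[where f = uminus and g = B, OF _ d0]) (auto intro!: derivative_eq_intros)
  moreover have "((\<lambda>s. exp s * B s) has_real_derivative exp 0 * B 0 + d * exp 0) (at 0)"
    by (rule derivative_eq_intros d refl | simp)+
  ultimately have "d * (- 1) = exp 0 * B 0 + d * exp 0"
    unfolding B_minus by (rule DERIV_unique)
  then have "d < 0" by (simp add: B_0)
  from has_real_derivative_neg_dec_right[OF d this]
  obtain e where e: "e > 0" "\<And>h. 0 < h \<Longrightarrow> h < e \<Longrightarrow> B h < 1" by (auto simp: B_0)
  \<comment> \<open>The strict drop is known only just to the right of \<open>0\<close>;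
    monotonicity carries it to \<open>x\<close>.\<close>
  define h where "h = min (e / 2) x"
  have "B x \<le> B h" by (rule B_antimono) (simp add: h_def)
  also have "\<dots> < 1" using e x by (intro e) (auto simp: h_def)
  finally show ?thesis .
qed

text \<open>By convexity, drops over a fixed length are larger further left, so a start at
  \<open>x \<le> 0\<close> does at least as well as a start at \<open>0\<close>.\<close>

lemma B_drop_at_0:
  assumes "x \<le> 0" "x + d \<le> y" "0 \<le> d"
  shows "1 - B d \<le> B x - B y"
  using convex_increments_mono[OF conv assms(1,3)] B_antimono[OF assms(2)] by (simp add: B_0)

text \<open>The chord from \<open>0\<close> to \<open>d\<close> lies above the graph. A drop at one
  fixed scale thus controls smaller steps linearly.\<close>

lemma B_drop_scale:
  assumes "0 < r" "r \<le> 1"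
  shows "r * (1 - B d) \<le> 1 - B (r * d)"
  using convex_onD[OF conv, of r 0 d] assms by (simp add: B_0 algebra_simps)

text \<open>As \<open>0\<close> is a convex combination of \<open>- d\<close> and \<open>1\<close>,
  the mean rate of fall over a length \<open>d\<close> before \<open>0\<close> is at least that from
  \<open>0\<close> to \<open>1\<close>. The bound is linear in \<open>d\<close>, as large steps
  require.\<close>

lemma B_drop_before_0:
  assumes x: "x \<le> - d" and y: "x + d \<le> y" and d: "0 \<le> d"
  shows "d * (1 - B 1) \<le> B x - B y"
proof -
  have "1 = B ((1 - d / (1 + d)) *\<^sub>R (- d) + (d / (1 + d)) *\<^sub>R 1)"
    using d by (simp add: B_0 field_simps)
  also have "\<dots> \<le> (1 - d / (1 + d)) * B (- d) + d / (1 + d) * B 1"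
    using d by (intro convex_onD[OF conv]) auto
  also have "1 - d / (1 + d) = 1 / (1 + d)"
    using d by (simp add: field_simps)
  finally have "1 \<le> (B (- d) + d * B 1) / (1 + d)"
    by (simp add: add_divide_distrib)
  then have "d * (1 - B 1) \<le> B (- d) - 1"
    using d by (simp add: pos_le_divide_eq algebra_simps)
  also have "\<dots> \<le> B x - B (x + d)"
    using convex_increments_mono[OF conv x d] by (simp add: B_0)
  also have "\<dots> \<le> B x - B y" using B_antimono[OF y] by simp
  finally show ?thesis .
qed

end

section \<open>Uniformly convex potentials and the curvature bound\<close>

locale convex_potential = convex_weight +
  fixes u :: "real \<Rightarrow> real" and lam :: real
  assumes smooth: "smooth_fun u" and lam_pos: "0 < lam" and u_convex: "\<And>x. lam \<le> deriv (deriv u) x"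
begin

lemma u_deriv: "(u has_real_derivative deriv u x) (at x)"
  "(deriv u has_real_derivative deriv (deriv u) x) (at x)"
proof -
  have "(deriv ^^ n) u differentiable (at x)" for n
    using smooth by (simp add: smooth_fun_def)
  from this[of 0] this[of 1]
  show "(u has_real_derivative deriv u x) (at x)" "(deriv u has_real_derivative deriv (deriv u) x) (at x)"
    by (simp_all add: DERIV_deriv_iff_real_differentiable)
qed

lemma u_minus_parabola_convex: "convex_on UNIV (\<lambda>x. u x - lam / 2 * x\<^sup>2)"
proof (rule f''_ge0_imp_convex)
  show "((\<lambda>x. u x - lam / 2 * x\<^sup>2) has_real_derivative deriv u x - lam * x) (at x)" for x
    by (rule derivative_eq_intros u_deriv refl | simp)+
  show "((\<lambda>x. deriv u x - lam * x) has_real_derivative deriv (deriv u) x - lam) (at x)" for x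
    by (rule derivative_eq_intros u_deriv refl | simp)+
qed (use u_convex in auto)

lemma u_lower: "u 0 + deriv u 0 * y + lam / 2 * y\<^sup>2 \<le> u y"
proof -
  have "((\<lambda>x. u x - lam / 2 * x\<^sup>2) has_real_derivative deriv u 0) (at 0)"
    by (rule derivative_eq_intros u_deriv refl | simp)+
  from convex_on_imp_above_tangent[OF u_minus_parabola_convex _ _ _ this, of y]
  show ?thesis by (simp add: algebra_simps)
qed

definition slope :: "real \<Rightarrow> int \<Rightarrow> real" where
  "slope h i = grid u h (i + 1) - grid u h i"

lemma up_rate_slope: "up_rate B u h i = B (slope h i) / h\<^sup>2"
  by (simp add: up_rate_def slope_def)

lemma down_rate_slope: "down_rate B u h i = B (- slope h (i - 1)) / h\<^sup>2"
  by (simp add: down_rate_def slope_def)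

text \<open>Increments of \<open>u\<close> minus the parabola are nondecreasing, and the parabola's
  second difference is \<open>lam * h\<^sup>2\<close>.\<close>

lemma slope_step:
  assumes "0 < h"
  shows "slope h i + lam * h\<^sup>2 \<le> slope h (i + 1)"
  using convex_increments_mono[OF u_minus_parabola_convex, of "of_int i * h" "of_int (i + 1) * h" h] assms
  by (simp add: slope_def grid_def algebra_simps power2_eq_square)

lemma slope_mono:
  assumes h: "0 < h" and "i \<le> j"
  shows "slope h i \<le> slope h j"
  using assms(2)
proof (induction j rule: int_ge_induct)
  case (step j)
  have "0 \<le> lam * h\<^sup>2" using lam_pos by simp
  with step slope_step[OF h, of j] show ?case by linarith
qed simp

text \<open>In \<open>u_lower\<close> at \<open>h\<close> and \<open>- h\<close>, the threshold on
  \<open>h\<close> limits the linear term to half of the quadratic one.\<close>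

lemma slope_around_0:
  assumes h: "4 * \<bar>deriv u 0\<bar> / lam \<le> h" "0 < h"
  shows "lam * h\<^sup>2 / 4 \<le> slope h 0" and "slope h (- 1) \<le> - (lam * h\<^sup>2 / 4)"
proof -
  have "4 * \<bar>deriv u 0\<bar> \<le> lam * h" using h lam_pos by (simp add: field_simps)
  then have "4 * \<bar>deriv u 0\<bar> * h \<le> lam * h * h" using h by (intro mult_right_mono) auto
  moreover have "\<bar>deriv u 0 * h\<bar> = \<bar>deriv u 0\<bar> * h" using h by (simp add: abs_mult)
  ultimately have "\<bar>deriv u 0 * h\<bar> \<le> lam * h\<^sup>2 / 4" by (simp add: power2_eq_square)
  then show "lam * h\<^sup>2 / 4 \<le> slope h 0" "slope h (- 1) \<le> - (lam * h\<^sup>2 / 4)"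
    using u_lower[of h] u_lower[of "- h"] by (auto simp: slope_def grid_def)
qed

text \<open>The entries of the minimum serve \<open>h \<le> H\<close> and \<open>h > H\<close>, and
  neither involves \<open>h\<close>. The \<open>+ 1\<close> keeps \<open>H\<close> positive when
  \<open>deriv u 0 = 0\<close>.\<close>

definition curv :: real where
  "curv = (let H = 4 * \<bar>deriv u 0\<bar> / lam + 1 in min ((1 - B (lam * H\<^sup>2)) / H\<^sup>2) (lam / 4 * (1 - B 1)))"

lemma curv_pos: "0 < curv"
proof -
  define H where "H = 4 * \<bar>deriv u 0\<bar> / lam + 1"
  have "H > 0" using lam_pos by (simp add: H_def add_nonneg_pos)
  then show ?thesis
    using lam_pos B_less_1[of "lam * H\<^sup>2"] B_less_1[of 1] by (simp add: curv_def Let_def flip: H_def)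
qed

text \<open>
  For small \<open>h\<close> the drop of \<open>B\<close> over a step of length \<open>lam * h\<^sup>2\<close> is comparable to \<open>h\<^sup>2\<close>.  This fails
  for large \<open>h\<close>, where one uses instead that \<open>0\<close> is a grid point, so that all slopes to the right
  of it are at least \<open>lam * h\<^sup>2 / 4\<close> and those to the left at most \<open>- lam * h\<^sup>2 / 4\<close>.
\<close>

lemma curvature_bound:
  assumes h: "0 < h"
  shows "curv \<le> up_rate B u h i - up_rate B u h (i + 1) + down_rate B u h (i + 1) - down_rate B u h i"
proof -
  define H where "H = 4 * \<bar>deriv u 0\<bar> / lam + 1"
  have H: "H > 0" using lam_pos by (simp add: H_def add_nonneg_pos)
  have step: "slope h i + lam * h\<^sup>2 \<le> slope h (i + 1)" "slope h (i - 1) + lam * h\<^sup>2 \<le> slope h i"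
    using slope_step[OF h, of i] slope_step[OF h, of "i - 1"] by auto
  have d: "0 \<le> lam * h\<^sup>2" using lam_pos by simp
  \<comment> \<open>\<open>X\<close> and \<open>Y\<close> are the upward and downward contributions
    scaled by \<open>h\<^sup>2\<close>. Both are nonnegative, so bounding one of them
    suffices.\<close>
  define X where "X = B (slope h i) - B (slope h (i + 1))"
  define Y where "Y = B (- slope h i) - B (- slope h (i - 1))"
  have XY: "0 \<le> X" "0 \<le> Y" unfolding X_def Y_def using step d by (auto intro!: B_antimono)
  have "curv * h\<^sup>2 \<le> X + Y"
  proof (cases "h \<le> H")
    case True
    have "1 - B (lam * h\<^sup>2) \<le> X + Y"
    \<comment> \<open>A drop starting at a nonpositive argument is wanted: \<open>X\<close> starts
      at the slope and \<open>Y\<close> at its negative, so one of them qualifies.\<close>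
    proof (cases "slope h i \<le> 0")
      case True
      then have "1 - B (lam * h\<^sup>2) \<le> X" unfolding X_def using step d by (intro B_drop_at_0) auto
      then show ?thesis using XY by simp
    next
      case False
      then have "1 - B (lam * h\<^sup>2) \<le> Y" unfolding Y_def using step d by (intro B_drop_at_0) auto
      then show ?thesis using XY by simp
    qed
    moreover have "h\<^sup>2 / H\<^sup>2 * (1 - B (lam * H\<^sup>2)) \<le> 1 - B (h\<^sup>2 / H\<^sup>2 * (lam * H\<^sup>2))"
      using True h H by (intro B_drop_scale) (auto simp: power_mono)
    moreover have "h\<^sup>2 / H\<^sup>2 * (lam * H\<^sup>2) = lam * h\<^sup>2" using H by simp
    moreover have "curv * h\<^sup>2 \<le> (1 - B (lam * H\<^sup>2)) / H\<^sup>2 * h\<^sup>2"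
      by (intro mult_right_mono) (simp_all add: curv_def Let_def flip: H_def)
    ultimately show ?thesis by (simp add: mult.commute)
  next
    case False
    then have s0: "lam * h\<^sup>2 / 4 \<le> slope h 0" "slope h (- 1) \<le> - (lam * h\<^sup>2 / 4)"
      using slope_around_0[of h] h by (auto simp: H_def)
    \<comment> \<open>The drop is taken over \<open>lam * h\<^sup>2 / 4\<close>, the guaranteed
      distance from \<open>0\<close>; the actual slope step is at least four times as long.\<close>
    have "lam * h\<^sup>2 / 4 * (1 - B 1) \<le> X + Y"
    proof (cases "i \<ge> 0")
      case True
      then have "lam * h\<^sup>2 / 4 \<le> slope h i" using s0 slope_mono[OF h True] by linarith
      then have "lam * h\<^sup>2 / 4 * (1 - B 1) \<le> Y"
        unfolding Y_def using step d by (intro B_drop_before_0) auto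
      then show ?thesis using XY by simp
    next
      case False
      then have "slope h i \<le> - (lam * h\<^sup>2 / 4)" using s0 slope_mono[OF h, of i "- 1"] by linarith
      then have "lam * h\<^sup>2 / 4 * (1 - B 1) \<le> X"
        unfolding X_def using step d by (intro B_drop_before_0) auto
      then show ?thesis using XY by simp
    qed
    moreover have "curv * h\<^sup>2 \<le> lam / 4 * (1 - B 1) * h\<^sup>2"
      by (intro mult_right_mono) (simp_all only: curv_def Let_def min.cobounded2 zero_le_power2)
    ultimately show ?thesis by (simp add: algebra_simps)
  qed
  then have "curv \<le> (X + Y) / h\<^sup>2" using h by (simp add: pos_le_divide_eq)
  then show ?thesis
    by (simp add: up_rate_slope down_rate_slope X_def Y_def diff_divide_distrib add_divide_distrib)
qed

lemma gibbs_weight_summable: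
  assumes h: "0 < h"
  shows "(\<lambda>i. exp (- grid u h i)) summable_on UNIV"
proof -
  \<comment> \<open>The part \<open>\<bar>deriv u 0\<bar>\<close> absorbs the linear term and the
    \<open>1\<close> leaves \<open>\<bar>y\<bar>\<close> over; \<open>K\<close> comes from
    completing the square.\<close>
  define p where "p = \<bar>deriv u 0\<bar> + 1"
  define K where "K = u 0 - p\<^sup>2 / (2 * lam)"
  have lower: "K + \<bar>y\<bar> \<le> u y" for y
  proof -
    have "0 \<le> (lam * \<bar>y\<bar> - p)\<^sup>2 / (2 * lam)" using lam_pos by simp
    also have "\<dots> = lam / 2 * y\<^sup>2 - p * \<bar>y\<bar> + p\<^sup>2 / (2 * lam)"
      using lam_pos by (simp add: power2_diff power_mult_distrib field_simps power2_eq_square)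
    finally have "p * \<bar>y\<bar> - p\<^sup>2 / (2 * lam) \<le> lam / 2 * y\<^sup>2" by simp
    moreover have "- (\<bar>deriv u 0\<bar> * \<bar>y\<bar>) \<le> deriv u 0 * y"
      using abs_ge_minus_self[of "deriv u 0 * y"] by (simp add: abs_mult)
    ultimately show ?thesis using u_lower[of y] by (simp add: K_def p_def algebra_simps)
  qed
  have le: "exp (- grid u h i) \<le> exp (- K) * exp (- h) ^ nat \<bar>i\<bar>" for i
  proof -
    have "exp (- grid u h i) \<le> exp (- (K + \<bar>of_int i * h\<bar>))"
      using lower[of "of_int i * h"] by (simp add: grid_def)
    also have "\<dots> = exp (- K) * exp (- h) ^ nat \<bar>i\<bar>"
      using h by (simp add: exp_add[symmetric] exp_of_nat_mult[symmetric] abs_mult)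
    finally show ?thesis .
  qed
  have "(\<lambda>i::int. exp (- K) * exp (- h) ^ nat \<bar>i\<bar>) summable_on UNIV"
    by (intro summable_on_cmult_right summable_on_int_geometric) (use h in auto)
  then show ?thesis by (rule summable_on_comparison_test) (use le in auto)
qed

text \<open>This is \<open>B_minus\<close> at the slope, whose exponential is the ratio of
  neighbouring weights.\<close>

lemma detailed_balance:
  "up_rate B u h i * exp (- grid u h i) = down_rate B u h (i + 1) * exp (- grid u h (i + 1))"
proof -
  have "exp (slope h i) * exp (- grid u h (i + 1)) = exp (- grid u h i)"
    by (simp add: slope_def flip: exp_add)
  then show ?thesis
    by (simp add: up_rate_slope down_rate_slope B_minus mult.commute mult.left_commute)
qed

lemma reversible:
  assumes h: "0 < h"
  shows "bd_reversible_finite (up_rate B u h) (down_rate B u h) (up_rate B u h 0 + down_rate B u h 0)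
           (\<lambda>i. exp (- grid u h i)) curv"
proof
  fix i :: int
  show pos: "0 < up_rate B u h i" for i
    unfolding up_rate_slope using h B_pos by simp
  then show "0 \<le> up_rate B u h i" by (rule less_imp_le)
  show nonneg: "0 \<le> down_rate B u h i" for i
    unfolding down_rate_slope using h B_pos by (simp add: less_imp_le)
  show "0 \<le> up_rate B u h 0 + down_rate B u h 0"
    using pos[of 0] nonneg[of 0] by linarith
  \<comment> \<open>Rates pointing away from \<open>0\<close> are largest at \<open>0\<close>,
    because slopes increase and \<open>B\<close> decreases. Inward rates may be unbounded but only
    lower the drift of \<open>\<bar>i\<bar>\<close>.\<close>
  have up: "up_rate B u h i \<le> up_rate B u h 0" if "0 \<le> i"
    unfolding up_rate_slope using slope_mono[OF h that] by (intro divide_right_mono B_antimono) auto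
  have down: "down_rate B u h i \<le> down_rate B u h 0" if "i \<le> 0"
    unfolding down_rate_slope using slope_mono[OF h, of "i - 1" "0 - 1"] that
    by (intro divide_right_mono B_antimono) auto
  show "bd_gen (up_rate B u h) (down_rate B u h) (\<lambda>j. \<bar>real_of_int j\<bar>) i
      \<le> up_rate B u h 0 + down_rate B u h 0"
    using up down pos[of i] nonneg[of i] pos[of 0] nonneg[of 0]
    by (cases "i = 0"; cases "i > 0") (auto simp: bd_gen_def)
  show "up_rate B u h i * exp (- grid u h i) = down_rate B u h (i + 1) * exp (- grid u h (i + 1))"
    by (rule detailed_balance)
  show "curv \<le> up_rate B u h i - up_rate B u h (i + 1) + down_rate B u h (i + 1) - down_rate B u h i"
    by (rule curvature_bound[OF h])
  show "0 < curv" by (rule curv_pos)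
  show m: "(\<lambda>i. exp (- grid u h i)) summable_on UNIV"
    by (rule gibbs_weight_summable[OF h])
  have shift: "bij_betw (\<lambda>i::int. i + 1) UNIV UNIV"
    by (rule bij_betwI[where g = "\<lambda>i. i - 1"]) auto
  have "(\<lambda>i. 1 / h\<^sup>2 * (exp (- grid u h i) + exp (- grid u h (i + 1)))) summable_on UNIV"
    using m summable_on_reindex_bij_betw[OF shift, of "\<lambda>i. exp (- grid u h i)"]
    by (intro summable_on_cmult_right summable_on_add) auto
  \<comment> \<open>The edge weight can be written from either endpoint; the sign of the slope
    selects the one where \<open>B \<le> 1\<close>.\<close>
  moreover have "up_rate B u h i * exp (- grid u h i) \<le> 1 / h\<^sup>2 * (exp (- grid u h i) + exp (- grid u h (i + 1)))" for i
  proof (cases "slope h i \<ge> 0")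
    case True
    then have "B (slope h i) \<le> 1" using B_antimono[OF True] by (simp add: B_0)
    then have "B (slope h i) * exp (- grid u h i) \<le> 1 * exp (- grid u h i)" by (intro mult_right_mono) auto
    also have "\<dots> \<le> exp (- grid u h i) + exp (- grid u h (i + 1))" by simp
    finally show ?thesis by (simp add: up_rate_slope divide_right_mono)
  next
    case False
    then have "B (- slope h i) \<le> 1" using B_antimono[of 0 "- slope h i"] by (simp add: B_0)
    then have "B (- slope h i) * exp (- grid u h (i + 1)) \<le> 1 * exp (- grid u h (i + 1))" by (intro mult_right_mono) auto
    also have "\<dots> \<le> exp (- grid u h i) + exp (- grid u h (i + 1))" by simp
    finally show ?thesis unfolding detailed_balance by (simp add: down_rate_slope divide_right_mono)
  qed
  ultimately show "(\<lambda>i. up_rate B u h i * exp (- grid u h i)) summable_on UNIV"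
    by (rule summable_on_comparison_test) (use pos in \<open>auto simp: less_imp_le\<close>)
qed auto

end

theorem corollary1p3:
  fixes B u :: "real \<Rightarrow> real" and lam :: real
  assumes "admissible B"
    and "convex_on UNIV B"
    and "smooth_fun u"
    and "lam > 0"
    and "\<And>x. deriv (deriv u) x \<ge> lam"
  shows "\<exists>\<theta>>0. \<forall>h>0. \<forall>f :: int \<Rightarrow> real. bounded (range f) \<longrightarrow>
           (\<forall>t\<ge>0. energy B u h (markov_semigroup B u h t f) \<le> exp (- \<theta> * t) * energy B u h f)"
proof -
  interpret convex_potential B u lam
    using assms by unfold_locales
  \<comment> \<open>The rate \<open>2 * curv\<close> is the witness for \<open>\<theta>\<close>; it
    depends only on \<open>B\<close>, \<open>u\<close> and \<open>lam\<close>.\<close>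
  have "energy B u h (markov_semigroup B u h t f) \<le> exp (- (2 * curv) * t) * energy B u h f"
    if h: "h > 0" and f: "bounded (range f)" and t: "t \<ge> 0" for h t and f :: "int \<Rightarrow> real"
  proof -
    interpret R: bd_reversible_finite "up_rate B u h" "down_rate B u h"
      "up_rate B u h 0 + down_rate B u h 0" "\<lambda>i. exp (- grid u h i)" curv
      by (rule reversible[OF h])
    obtain M where M: "\<And>i. \<bar>f i\<bar> \<le> M"
      using f unfolding bounded_iff by auto
    obtain V where V: "bd_flow (up_rate B u h) (down_rate B u h) M f V"
      "\<And>t. 0 \<le> t \<Longrightarrow> R.variance (V t) + R.dirichlet (V t)
          \<le> exp (- (2 * curv) * t) * (R.variance f + R.dirichlet f)"
      by (rule R.energy_decay[of f M, OF M]) (rule that)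
    have VM: "\<bar>V t i\<bar> \<le> M" for i using V(1) t by (simp add: bd_flow_def)
    have "markov_semigroup B u h t f = V t"
      by (intro ext markov_semigroup_eq_bd_flow[OF R.bd_chain_axioms V(1) t])
    then show ?thesis
      using divide_right_mono[OF V(2)[OF t], of R.mass] R.mass_pos
      by (simp add: R.energy_eq[OF refl refl refl VM] R.energy_eq[OF refl refl refl M])
  qed
  moreover have "0 < 2 * curv" using curv_pos by simp
  ultimately show ?thesis by blast
qed

end
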